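(* Let $(M_1,g_1)$ and $(M_2,g_2)$ be Riemannian manifolds and let $N=M_1\times M_2$ be their Riemannian product, with product metric $g$. Let $\tau$ and $\kappa$ be the tension field and conformality operator on $N$. Suppose that $\mathcal E_1$ is an eigenfamily on $M_1$ with eigenvalues $\lambda_1$ and $\mu_1$, and that $\mathcal E_2$ is an eigenfamily on $M_2$ with eigenvalues $\lambda_2$ and $\mu_2$. Then the set $$\mathcal E=\{\psi:N\to\mathbb C,\ \psi:(p_1,p_2)\mapsto\phi_1(p_1)\cdot\phi_2(p_2)\ |\ \phi_1\in\mathcal E_1,\ \phi_2\in\mathcal E_2\}$$ is an eigenfamily on the product space $N$, with $$\tau(\phi)=(\lambda_1+\lambda_2)\cdot\phi\quad\text{and}\quad\kappa(\phi,\psi)=(\mu_1+\mu_2)\cdot\phi\psi$$ for all $\phi,\psi\in\mathcal E$.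
   Context: On a Riemannian manifold $(M,g)$, with $g$ extended complex-bilinearly to the complexified tangent bundle, the tension field of a complex-valued function $f$ is $\tau(f)=\operatorname{div}(\nabla f)$ and the conformality operator is $\kappa(f,h)=g(\nabla f,\nabla h)$. A collection $\mathcal E$ of smooth complex-valued functions on $M$ is an eigenfamily with eigenvalues $\lambda,\mu\in\mathbb C$ (for $\tau$ and $\kappa$ respectively) if $\tau(\phi)=\lambda\cdot\phi$ and $\kappa(\phi,\psi)=\mu\cdot\phi\psi$ for all $\phi,\psi\in\mathcal E$. *)

theory Defs
  imports "HOL-Analysis.Analysis"
begin

section \<open>Smooth maps on open sets\<close>

text \<open>Only used for open \<open>S\<close>. A map is \<open>C\<^sup>k\<^sup>+\<^sup>1\<close> iff it is differentiable and
  every directional derivative is \<open>C\<^sup>k\<close>.\<close>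

primrec Ck_on :: "nat \<Rightarrow> 'e::real_normed_vector set \<Rightarrow> ('e \<Rightarrow> 'f::real_normed_vector) \<Rightarrow> bool" where
  "Ck_on 0 S f \<longleftrightarrow> continuous_on S f"
| "Ck_on (Suc k) S f \<longleftrightarrow>
     (\<forall>x\<in>S. f differentiable (at x)) \<and>
     (\<forall>v. Ck_on k S (\<lambda>x. frechet_derivative f (at x) v))"

definition smooth_on :: "'e::real_normed_vector set \<Rightarrow> ('e \<Rightarrow> 'f::real_normed_vector) \<Rightarrow> bool" where
  "smooth_on S f \<longleftrightarrow> (\<forall>k. Ck_on k S f)"


section \<open>Riemannian manifolds\<close>

text \<open>
  A manifold is given by its topology on a carrier set of points and an atlas, a family of charts
  \<open>rm_chart M i\<close> on \<open>rm_dom M i\<close>, where \<open>i\<close> ranges over \<open>rm_index M\<close>. Tensor fields are given by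
  their local representatives in the charts: \<open>rm_metric M i x u v\<close> is the value of the metric on
  the tangent vectors with components \<open>u\<close> and \<open>v\<close> with respect to chart \<open>i\<close>, at the point whose
  coordinate is \<open>x\<close>. The dimension of the manifold is \<open>DIM('m)\<close>.
\<close>

record ('a, 'm, 'i) riem =
  rm_top :: "'a topology"
  rm_index :: "'i set"
  rm_dom :: "'i \<Rightarrow> 'a set"
  rm_chart :: "'i \<Rightarrow> 'a \<Rightarrow> 'm"
  rm_metric :: "'i \<Rightarrow> 'm \<Rightarrow> 'm \<Rightarrow> 'm \<Rightarrow> real"

definition chart_image :: "('a, 'm, 'i) riem \<Rightarrow> 'i \<Rightarrow> 'm set" where
  "chart_image M i = rm_chart M i ` rm_dom M i"

definition chart_inv :: "('a, 'm, 'i) riem \<Rightarrow> 'i \<Rightarrow> 'm \<Rightarrow> 'a" where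
  "chart_inv M i = inv_into (rm_dom M i) (rm_chart M i)"

definition transition :: "('a, 'm, 'i) riem \<Rightarrow> 'i \<Rightarrow> 'i \<Rightarrow> 'm \<Rightarrow> 'm" where
  "transition M i j = rm_chart M j \<circ> chart_inv M i"

definition smooth_manifold :: "('a, 'm::euclidean_space, 'i) riem \<Rightarrow> bool" where
  "smooth_manifold M \<longleftrightarrow>
     Hausdorff_space (rm_top M) \<and> second_countable (rm_top M) \<and>
     (\<forall>i\<in>rm_index M.
        openin (rm_top M) (rm_dom M i) \<and> open (chart_image M i) \<and>
        homeomorphic_map (subtopology (rm_top M) (rm_dom M i))
          (top_of_set (chart_image M i)) (rm_chart M i)) \<and>
     (\<Union>i\<in>rm_index M. rm_dom M i) = topspace (rm_top M) \<and>
     (\<forall>i\<in>rm_index M. \<forall>j\<in>rm_index M.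
        smooth_on (rm_chart M i ` (rm_dom M i \<inter> rm_dom M j)) (transition M i j))"

definition inner_product_form :: "('m::real_vector \<Rightarrow> 'm \<Rightarrow> real) \<Rightarrow> bool" where
  "inner_product_form g \<longleftrightarrow>
     bilinear g \<and> (\<forall>u v. g u v = g v u) \<and> (\<forall>u. u \<noteq> 0 \<longrightarrow> g u u > 0)"

text \<open>The last clause is the transformation law of a \<open>(0,2)\<close>-tensor field.\<close>

definition riemannian_manifold :: "('a, 'm::euclidean_space, 'i) riem \<Rightarrow> bool" where
  "riemannian_manifold M \<longleftrightarrow>
     smooth_manifold M \<and>
     (\<forall>i\<in>rm_index M.
        (\<forall>x\<in>chart_image M i. inner_product_form (rm_metric M i x)) \<and>
        (\<forall>u v. smooth_on (chart_image M i) (\<lambda>x. rm_metric M i x u v))) \<and>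
     (\<forall>i\<in>rm_index M. \<forall>j\<in>rm_index M. \<forall>x\<in>rm_chart M i ` (rm_dom M i \<inter> rm_dom M j). \<forall>u v.
        rm_metric M i x u v =
          rm_metric M j (transition M i j x)
            (frechet_derivative (transition M i j) (at x) u)
            (frechet_derivative (transition M i j) (at x) v))"

definition riem_product ::
  "('a, 'm, 'i) riem \<Rightarrow> ('b, 'n, 'j) riem \<Rightarrow> ('a \<times> 'b, 'm \<times> 'n, 'i \<times> 'j) riem" where
  "riem_product M1 M2 =
     \<lparr> rm_top = prod_topology (rm_top M1) (rm_top M2),
       rm_index = rm_index M1 \<times> rm_index M2,
       rm_dom = (\<lambda>(i, j). rm_dom M1 i \<times> rm_dom M2 j),
       rm_chart = (\<lambda>(i, j) (p, q). (rm_chart M1 i p, rm_chart M2 j q)),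
       rm_metric = (\<lambda>(i, j) (x, y) (u1, u2) (v1, v2).
          rm_metric M1 i x u1 v1 + rm_metric M2 j y u2 v2) \<rparr>"

definition coord_rep :: "('a, 'm, 'i) riem \<Rightarrow> ('a \<Rightarrow> 'c) \<Rightarrow> 'i \<Rightarrow> 'm \<Rightarrow> 'c" where
  "coord_rep M f i = f \<circ> chart_inv M i"

definition smooth_function ::
  "('a, 'm::real_normed_vector, 'i) riem \<Rightarrow> ('a \<Rightarrow> 'c::real_normed_vector) \<Rightarrow> bool" where
  "smooth_function M f \<longleftrightarrow> (\<forall>i\<in>rm_index M. smooth_on (chart_image M i) (coord_rep M f i))"


section \<open>Gradient and divergence in a single chart\<close>

text \<open>In this section \<open>G\<close> is the local representative of the metric.
  \<open>sharp g \<alpha>\<close> is the vector that represents the linear form \<open>\<alpha>\<close> with respect to the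
  inner product \<open>g\<close>.\<close>

definition sharp :: "('m \<Rightarrow> 'm \<Rightarrow> real) \<Rightarrow> ('m \<Rightarrow> real) \<Rightarrow> 'm" where
  "sharp g \<alpha> = (THE w. \<forall>v. g w v = \<alpha> v)"

definition local_gradient ::
  "('m::euclidean_space \<Rightarrow> 'm \<Rightarrow> 'm \<Rightarrow> real) \<Rightarrow> ('m \<Rightarrow> real) \<Rightarrow> 'm \<Rightarrow> 'm" where
  "local_gradient G u x = sharp (G x) (frechet_derivative u (at x))"

text \<open>The Christoffel symbols of the Levi-Civita connection, from the Koszul formula for the
  constant (hence commuting) vector fields \<open>u\<close>, \<open>v\<close>, \<open>w\<close>.\<close>

definition christoffel ::
  "('m::euclidean_space \<Rightarrow> 'm \<Rightarrow> 'm \<Rightarrow> real) \<Rightarrow> 'm \<Rightarrow> 'm \<Rightarrow> 'm \<Rightarrow> 'm" where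
  "christoffel G x u v =
     sharp (G x) (\<lambda>w. (frechet_derivative (\<lambda>y. G y v w) (at x) u
                      + frechet_derivative (\<lambda>y. G y u w) (at x) v
                      - frechet_derivative (\<lambda>y. G y u v) (at x) w) / 2)"

definition covariant_derivative ::
  "('m::euclidean_space \<Rightarrow> 'm \<Rightarrow> 'm \<Rightarrow> real) \<Rightarrow> ('m \<Rightarrow> 'm) \<Rightarrow> 'm \<Rightarrow> 'm \<Rightarrow> 'm" where
  "covariant_derivative G X x v = frechet_derivative X (at x) v + christoffel G x v (X x)"

text \<open>The divergence of \<open>X\<close> is the trace of \<open>v \<mapsto> \<nabla>\<^sub>v X\<close>. The trace does not depend on the
  metric, so it can be computed in the standard basis of the model space.\<close>

definition local_divergence ::
  "('m::euclidean_space \<Rightarrow> 'm \<Rightarrow> 'm \<Rightarrow> real) \<Rightarrow> ('m \<Rightarrow> 'm) \<Rightarrow> 'm \<Rightarrow> real" where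
  "local_divergence G X x = (\<Sum>b\<in>Basis. covariant_derivative G X x b \<bullet> b)"


section \<open>Tension field and conformality operator\<close>

text \<open>
  A vector field is given by its local representatives \<open>X i x\<close>, one for each chart \<open>i\<close>. Scalars at
  a point \<open>p\<close> are evaluated in an arbitrary chart around \<open>p\<close>; for fields that obey the vector
  transformation law, such as gradients, the value does not depend on the chart.
\<close>

definition chart_at :: "('a, 'm, 'i) riem \<Rightarrow> 'a \<Rightarrow> 'i" where
  "chart_at M p = (SOME i. i \<in> rm_index M \<and> p \<in> rm_dom M i)"

definition gradient :: "('a, 'm::euclidean_space, 'i) riem \<Rightarrow> ('a \<Rightarrow> real) \<Rightarrow> 'i \<Rightarrow> 'm \<Rightarrow> 'm" where
  "gradient M u i = local_gradient (rm_metric M i) (coord_rep M u i)"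

definition divergence :: "('a, 'm::euclidean_space, 'i) riem \<Rightarrow> ('i \<Rightarrow> 'm \<Rightarrow> 'm) \<Rightarrow> 'a \<Rightarrow> real" where
  "divergence M X p =
     (let i = chart_at M p in local_divergence (rm_metric M i) (X i) (rm_chart M i p))"

text \<open>An element \<open>a + i b\<close> of the complexified tangent space is the pair \<open>(a, b)\<close> of its real and
  imaginary parts. Gradient, divergence and metric are extended complex-(bi)linearly;
  in particular the metric is not extended to a Hermitian form.\<close>

type_synonym 'm complexified = "'m \<times> 'm"

definition complex_bilinear_ext ::
  "('m \<Rightarrow> 'm \<Rightarrow> real) \<Rightarrow> 'm complexified \<Rightarrow> 'm complexified \<Rightarrow> complex" where
  "complex_bilinear_ext g Z W =
     Complex (g (fst Z) (fst W) - g (snd Z) (snd W)) (g (fst Z) (snd W) + g (snd Z) (fst W))"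

definition complex_gradient ::
  "('a, 'm::euclidean_space, 'i) riem \<Rightarrow> ('a \<Rightarrow> complex) \<Rightarrow> 'i \<Rightarrow> 'm \<Rightarrow> 'm complexified" where
  "complex_gradient M f i x =
     (gradient M (\<lambda>p. Re (f p)) i x, gradient M (\<lambda>p. Im (f p)) i x)"

definition complex_divergence ::
  "('a, 'm::euclidean_space, 'i) riem \<Rightarrow> ('i \<Rightarrow> 'm \<Rightarrow> 'm complexified) \<Rightarrow> 'a \<Rightarrow> complex" where
  "complex_divergence M Z p =
     Complex (divergence M (\<lambda>i x. fst (Z i x)) p) (divergence M (\<lambda>i x. snd (Z i x)) p)"

definition tension_field ::
  "('a, 'm::euclidean_space, 'i) riem \<Rightarrow> ('a \<Rightarrow> complex) \<Rightarrow> 'a \<Rightarrow> complex" where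
  "tension_field M f = complex_divergence M (complex_gradient M f)"

definition conformality_operator ::
  "('a, 'm::euclidean_space, 'i) riem \<Rightarrow> ('a \<Rightarrow> complex) \<Rightarrow> ('a \<Rightarrow> complex) \<Rightarrow> 'a \<Rightarrow> complex" where
  "conformality_operator M f h p =
     (let i = chart_at M p; x = rm_chart M i p
      in complex_bilinear_ext (rm_metric M i x) (complex_gradient M f i x) (complex_gradient M h i x))"

text \<open>Functions on the manifold are total; only their values on \<open>topspace (rm_top M)\<close> matter.\<close>

definition eigenfamily ::
  "('a, 'm::euclidean_space, 'i) riem \<Rightarrow> ('a \<Rightarrow> complex) set \<Rightarrow> complex \<Rightarrow> complex \<Rightarrow> bool" where
  "eigenfamily M E lam mu \<longleftrightarrow>
     riemannian_manifold M \<and>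
     (\<forall>\<phi>\<in>E. smooth_function M \<phi>) \<and>
     (\<forall>\<phi>\<in>E. \<forall>p\<in>topspace (rm_top M). tension_field M \<phi> p = lam * \<phi> p) \<and>
     (\<forall>\<phi>\<in>E. \<forall>\<psi>\<in>E. \<forall>p\<in>topspace (rm_top M).
        conformality_operator M \<phi> \<psi> p = mu * (\<phi> p * \<psi> p))"

end

theory Submission
  imports Defs
begin

text \<open>
  Write \<open>\<psi>(p, q) = \<phi>\<^sub>1(p) \<phi>\<^sub>2(q)\<close>. In a product chart the metric is block diagonal and each block depends
  on its own coordinates only, so the Christoffel symbols and gradients split as well
  (\<open>christoffel_product\<close>, \<open>local_gradient_product\<close>). Hence, at \<open>(x, y)\<close>, the Laplacian of any smooth
  function \<open>f\<close> is the Laplacian of \<open>f(\<cdot>, y)\<close> plus that of \<open>f(x, \<cdot>)\<close>, and the conformality operator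
  splits in the same way (\<open>local_laplacian_product\<close>, \<open>local_conformality_product\<close>). For \<open>\<psi>\<close>, both slices
  are constant complex multiples of \<open>\<phi>\<^sub>1\<close> or \<open>\<phi>\<^sub>2\<close>, so complex linearity of \<open>\<tau>\<close> and bilinearity of
  \<open>\<kappa>\<close> suffice and no product rule for \<open>\<tau>\<close> is needed:
  \<open>\<tau>(\<psi>) = \<tau>(\<phi>\<^sub>1) \<phi>\<^sub>2 + \<phi>\<^sub>1 \<tau>(\<phi>\<^sub>2)\<close>, and similarly for \<open>\<kappa>\<close>.

  Two further points carry most of the work. First, the operators are evaluated in the chart
  \<open>chart_at\<close>, and the chart chosen on the product at \<open>(p, q)\<close> need not be the pair of the charts
  chosen at \<open>p\<close> and \<open>q\<close>. So \<open>\<tau>\<close> and \<open>\<kappa>\<close> must be shown independent of the chart: gradients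
  transform by the derivative \<open>DT\<close> of the transition map, the Christoffel symbols pick up the second
  derivative of \<open>T\<close> (\<open>christoffel_change\<close>, which rests on the symmetry of second derivatives), this
  term cancels against the one produced by differentiating \<open>DT y (Y y)\<close>, and the trace is invariant
  under conjugation by \<open>DT\<close>. Second, these computations need gradients to be differentiable, that
  is, the solution of a linear system to depend differentiably on the system
  (\<open>differentiable_sharp\<close>).
\<close>


section \<open>Calculus of smooth maps\<close>

lemma Ck_on_subset: "Ck_on k S f \<Longrightarrow> T \<subseteq> S \<Longrightarrow> Ck_on k T f"
proof (induction k arbitrary: f)
  case 0
  then show ?case by (auto intro: continuous_on_subset)
next
  case (Suc k)
  then show ?case by (simp add: subset_iff)
qed

lemma Ck_on_cong:
  assumes "open S" "\<And>x. x \<in> S \<Longrightarrow> f x = g x" "Ck_on k S f"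
  shows "Ck_on k S g"
  using assms(2,3)
proof (induction k arbitrary: f g)
  case 0
  then show ?case using continuous_on_cong[of S S f g] by simp
next
  case (Suc k)
  have d: "(g has_derivative frechet_derivative f (at x)) (at x)" if "x \<in> S" for x
  proof (rule has_derivative_transform_within_open[OF _ \<open>open S\<close> that])
    show "(f has_derivative frechet_derivative f (at x)) (at x)"
      using Suc.prems(2) that by (simp add: frechet_derivative_works)
  qed (use Suc.prems(1) in auto)
  then have e: "frechet_derivative g (at x) = frechet_derivative f (at x)" if "x \<in> S" for x
    using that frechet_derivative_at by metis
  have "Ck_on k S (\<lambda>x. frechet_derivative g (at x) v)" for v
    using Suc.IH[of "\<lambda>x. frechet_derivative f (at x) v" "\<lambda>x. frechet_derivative g (at x) v"] e Suc.prems
    by simp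
  with d show ?case by (auto simp: differentiable_def)
qed

lemma Ck_on_SucI:
  assumes "open S" "\<And>x. x \<in> S \<Longrightarrow> (f has_derivative f' x) (at x)" "\<And>v. Ck_on k S (\<lambda>x. f' x v)"
  shows "Ck_on (Suc k) S f"
proof -
  have e: "frechet_derivative f (at x) = f' x" if "x \<in> S" for x
    using assms(2)[OF that] frechet_derivative_at by metis
  have "Ck_on k S (\<lambda>x. frechet_derivative f (at x) v)" for v
    by (rule Ck_on_cong[OF \<open>open S\<close> _ assms(3)[of v]]) (simp add: e)
  with assms(2) show ?thesis by (auto simp: differentiable_def)
qed

lemma Ck_on_Suc_has_derivative:
  assumes "Ck_on (Suc k) S f" "x \<in> S"
  shows "(f has_derivative frechet_derivative f (at x)) (at x)"
  using assms by (simp add: frechet_derivative_works)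

lemma Ck_on_Suc_lower: "Ck_on (Suc k) S f \<Longrightarrow> Ck_on k S f"
proof (induction k arbitrary: f)
  case 0
  then show ?case
    by (auto intro!: continuous_at_imp_continuous_on differentiable_imp_continuous_within)
next
  case (Suc k)
  show ?case unfolding Ck_on.simps(2)[of k]
  proof (intro conjI allI)
    show "\<forall>x\<in>S. f differentiable at x" using Suc.prems by simp
    show "Ck_on k S (\<lambda>x. frechet_derivative f (at x) v)" for v
      by (rule Suc.IH) (use Suc.prems in \<open>simp only: Ck_on.simps(2)[of "Suc k"]\<close>)
  qed
qed

lemma Ck_on_bounded_linear:
  assumes "bounded_linear L" "open S" "Ck_on k S f"
  shows "Ck_on k S (\<lambda>x. L (f x))"
  using assms(3)
proof (induction k arbitrary: f)
  case 0
  then show ?case by (simp add: bounded_linear.continuous_on[OF assms(1)])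
next
  case (Suc k)
  show ?case
  proof (rule Ck_on_SucI[OF \<open>open S\<close>])
    show "((\<lambda>x. L (f x)) has_derivative (\<lambda>v. L (frechet_derivative f (at x) v))) (at x)" if "x \<in> S" for x
      by (rule bounded_linear.has_derivative[OF assms(1) Ck_on_Suc_has_derivative[OF Suc.prems that]])
    show "Ck_on k S (\<lambda>x. L (frechet_derivative f (at x) v))" for v
      by (rule Suc.IH) (use Suc.prems in simp)
  qed
qed

lemma Ck_on_add:
  assumes "open S" "Ck_on k S f" "Ck_on k S g"
  shows "Ck_on k S (\<lambda>x. f x + g x)"
  using assms(2,3)
proof (induction k arbitrary: f g)
  case 0
  then show ?case by (simp add: continuous_on_add)
next
  case (Suc k)
  show ?case
  proof (rule Ck_on_SucI[OF \<open>open S\<close>])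
    show "((\<lambda>x. f x + g x) has_derivative
        (\<lambda>v. frechet_derivative f (at x) v + frechet_derivative g (at x) v)) (at x)" if "x \<in> S" for x
      using Suc.prems that by (intro has_derivative_add Ck_on_Suc_has_derivative)
    show "Ck_on k S (\<lambda>x. frechet_derivative f (at x) v + frechet_derivative g (at x) v)" for v
      by (rule Suc.IH) (use Suc.prems in simp_all)
  qed
qed

lemma Ck_on_bounded_bilinear:
  assumes "bounded_bilinear B" "open S" "Ck_on k S f" "Ck_on k S g"
  shows "Ck_on k S (\<lambda>x. B (f x) (g x))"
  using assms(3,4)
proof (induction k arbitrary: f g)
  case 0
  then show ?case by (simp add: bounded_bilinear.continuous_on[OF assms(1)])
next
  case (Suc k)
  show ?case
  proof (rule Ck_on_SucI[OF \<open>open S\<close>])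
    show "((\<lambda>x. B (f x) (g x)) has_derivative
        (\<lambda>v. B (f x) (frechet_derivative g (at x) v) + B (frechet_derivative f (at x) v) (g x))) (at x)"
      if "x \<in> S" for x
      using Suc.prems that
      by (intro bounded_bilinear.FDERIV[OF assms(1)] Ck_on_Suc_has_derivative)
    show "Ck_on k S (\<lambda>x. B (f x) (frechet_derivative g (at x) v) + B (frechet_derivative f (at x) v) (g x))"
      for v
      using Suc.prems Ck_on_Suc_lower[OF Suc.prems(1)] Ck_on_Suc_lower[OF Suc.prems(2)]
      by (intro Ck_on_add[OF \<open>open S\<close>] Suc.IH) simp_all
  qed
qed

lemma Ck_on_comp_bounded_linear:
  assumes "bounded_linear L" "open S" "L ` S \<subseteq> T" "Ck_on k T f"
  shows "Ck_on k S (\<lambda>x. f (L x))"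
  using assms(4)
proof (induction k arbitrary: f)
  case 0
  then show ?case
    using assms(3) by (auto intro!: continuous_on_compose2[of T f]
        linear_continuous_on[OF assms(1)])
next
  case (Suc k)
  show ?case
  proof (rule Ck_on_SucI[OF \<open>open S\<close>])
    show "((\<lambda>x. f (L x)) has_derivative (\<lambda>v. frechet_derivative f (at (L x)) (L v))) (at x)"
      if "x \<in> S" for x
    proof (rule has_derivative_compose[OF bounded_linear_imp_has_derivative[OF assms(1)]])
      show "(f has_derivative frechet_derivative f (at (L x))) (at (L x))"
        using Ck_on_Suc_has_derivative[OF Suc.prems] assms(3) that by blast
    qed
    show "Ck_on k S (\<lambda>x. frechet_derivative f (at (L x)) (L v))" for v
      by (rule Suc.IH) (use Suc.prems in simp)
  qed
qed

lemma smooth_on_subset: "smooth_on S f \<Longrightarrow> T \<subseteq> S \<Longrightarrow> smooth_on T f"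
  by (auto simp: smooth_on_def intro: Ck_on_subset)

lemma smooth_on_cong:
  "open S \<Longrightarrow> (\<And>x. x \<in> S \<Longrightarrow> f x = g x) \<Longrightarrow> smooth_on S f \<Longrightarrow> smooth_on S g"
  unfolding smooth_on_def using Ck_on_cong[of S f g] by auto

lemma smooth_on_add:
  "open S \<Longrightarrow> smooth_on S f \<Longrightarrow> smooth_on S g \<Longrightarrow> smooth_on S (\<lambda>x. f x + g x)"
  unfolding smooth_on_def by (rule allI, rule Ck_on_add) auto

lemma smooth_on_bounded_linear:
  "bounded_linear L \<Longrightarrow> open S \<Longrightarrow> smooth_on S f \<Longrightarrow> smooth_on S (\<lambda>x. L (f x))"
  unfolding smooth_on_def by (rule allI, rule Ck_on_bounded_linear) auto

lemma smooth_on_bounded_bilinear: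
  "bounded_bilinear B \<Longrightarrow> open S \<Longrightarrow> smooth_on S f \<Longrightarrow> smooth_on S g
    \<Longrightarrow> smooth_on S (\<lambda>x. B (f x) (g x))"
  unfolding smooth_on_def by (rule allI, rule Ck_on_bounded_bilinear) auto

lemma smooth_on_comp_bounded_linear:
  "bounded_linear L \<Longrightarrow> open S \<Longrightarrow> L ` S \<subseteq> T \<Longrightarrow> smooth_on T f
    \<Longrightarrow> smooth_on S (\<lambda>x. f (L x))"
  unfolding smooth_on_def by (rule allI, rule Ck_on_comp_bounded_linear) auto

lemma smooth_on_Pair:
  fixes f :: "'a::real_normed_vector \<Rightarrow> 'b::real_normed_vector"
    and g :: "'a \<Rightarrow> 'c::real_normed_vector"
  assumes "open S" "smooth_on S f" "smooth_on S g"
  shows "smooth_on S (\<lambda>x. (f x, g x))"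
proof -
  have "smooth_on S (\<lambda>x. (f x, 0 :: 'c))"
    by (rule smooth_on_bounded_linear[of "\<lambda>a. (a, 0)"])
      (use assms in \<open>auto intro: bounded_linear_Pair bounded_linear_ident bounded_linear_zero\<close>)
  moreover have "smooth_on S (\<lambda>x. (0 :: 'b, g x))"
    by (rule smooth_on_bounded_linear[of "\<lambda>b. (0, b)"])
      (use assms in \<open>auto intro: bounded_linear_Pair bounded_linear_ident bounded_linear_zero\<close>)
  ultimately have "smooth_on S (\<lambda>x. (f x, 0) + (0, g x))"
    by (rule smooth_on_add[OF assms(1)])
  then show ?thesis by simp
qed

lemma smooth_on_has_derivative:
  "smooth_on S f \<Longrightarrow> x \<in> S \<Longrightarrow> (f has_derivative frechet_derivative f (at x)) (at x)"
  by (metis Ck_on_Suc_has_derivative smooth_on_def)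

lemma smooth_on_differentiable: "smooth_on S f \<Longrightarrow> x \<in> S \<Longrightarrow> f differentiable (at x)"
  by (metis differentiable_def smooth_on_has_derivative)

lemma smooth_on_continuous_on: "smooth_on S f \<Longrightarrow> continuous_on S f"
  by (metis Ck_on.simps(1) smooth_on_def)

lemma smooth_on_frechet_derivative:
  "smooth_on S f \<Longrightarrow> smooth_on S (\<lambda>x. frechet_derivative f (at x) v)"
  unfolding smooth_on_def using Ck_on.simps(2) by blast

lemma frechet_derivative_eqI: "(f has_derivative f') (at x) \<Longrightarrow> frechet_derivative f (at x) = f'"
  using frechet_derivative_at by metis


section \<open>Differentiating families of linear maps\<close>

lemma linear_sum_Basis:
  fixes f :: "'m::euclidean_space \<Rightarrow> 'b::real_vector"
  assumes "linear f" shows "f w = (\<Sum>b\<in>Basis. (w \<bullet> b) *\<^sub>R f b)"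
proof -
  have "f w = f (\<Sum>b\<in>Basis. (w \<bullet> b) *\<^sub>R b)" by (simp add: euclidean_representation)
  also have "\<dots> = (\<Sum>b\<in>Basis. (w \<bullet> b) *\<^sub>R f b)"
    using assms by (simp add: linear_sum linear_cmul)
  finally show ?thesis .
qed

text \<open>A limit of difference quotients of linear maps is linear.\<close>

lemma linear_has_derivative_family:
  fixes A :: "'e::real_normed_vector \<Rightarrow> 'm::real_vector \<Rightarrow> 'f::real_normed_vector"
  assumes "open S" "x \<in> S" and lin: "\<And>y. y \<in> S \<Longrightarrow> linear (A y)"
    and A: "\<And>v. ((\<lambda>y. A y v) has_derivative (\<lambda>h. A' h v)) (at x)"
  shows "linear (A' h)"
proof (rule linearI)
  fix u v :: 'm and c :: real
  have "((\<lambda>y. A y u + A y v) has_derivative (\<lambda>h. A' h u + A' h v)) (at x)"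
    by (intro has_derivative_add A)
  moreover have "((\<lambda>y. A y u + A y v) has_derivative (\<lambda>h. A' h (u + v))) (at x)"
    by (rule has_derivative_transform_within_open[OF A[of "u + v"] assms(1,2)])
      (simp add: lin linear_add)
  ultimately have "(\<lambda>h. A' h (u + v)) = (\<lambda>h. A' h u + A' h v)"
    by (rule has_derivative_unique[rotated])
  then show "A' h (u + v) = A' h u + A' h v" by (rule fun_cong)
  have "((\<lambda>y. c *\<^sub>R A y u) has_derivative (\<lambda>h. c *\<^sub>R A' h u)) (at x)"
    by (intro has_derivative_scaleR_right A)
  moreover have "((\<lambda>y. c *\<^sub>R A y u) has_derivative (\<lambda>h. A' h (c *\<^sub>R u))) (at x)"
    by (rule has_derivative_transform_within_open[OF A[of "c *\<^sub>R u"] assms(1,2)])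
      (simp add: lin linear_cmul)
  ultimately have "(\<lambda>h. A' h (c *\<^sub>R u)) = (\<lambda>h. c *\<^sub>R A' h u)"
    by (rule has_derivative_unique[rotated])
  then show "A' h (c *\<^sub>R u) = c *\<^sub>R A' h u" by (rule fun_cong)
qed

text \<open>The Leibniz rule for \<open>y \<mapsto> A y (W y)\<close>, where \<open>A y\<close> is linear and \<open>A\<close> is only known to be
  differentiable at each fixed vector; this is enough because the vectors range over a
  finite-dimensional space.\<close>

lemma has_derivative_linear_family:
  fixes A :: "'e::real_normed_vector \<Rightarrow> 'm::euclidean_space \<Rightarrow> 'f::real_normed_vector"
  assumes "open S" "x \<in> S" and lin: "\<And>y. y \<in> S \<Longrightarrow> linear (A y)"
    and A: "\<And>v. ((\<lambda>y. A y v) has_derivative (\<lambda>h. A' h v)) (at x)"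
    and W: "(W has_derivative W') (at x)"
  shows "((\<lambda>y. A y (W y)) has_derivative (\<lambda>h. A' h (W x) + A x (W' h))) (at x)"
proof -
  note linA' = linear_has_derivative_family[OF assms(1,2) lin A]
  have "((\<lambda>y. \<Sum>b\<in>Basis. (W y \<bullet> b) *\<^sub>R A y b) has_derivative
      (\<lambda>h. \<Sum>b\<in>Basis. (W x \<bullet> b) *\<^sub>R A' h b + (W' h \<bullet> b) *\<^sub>R A x b)) (at x)"
    by (rule has_derivative_sum) (rule has_derivative_scaleR[OF has_derivative_inner_left[OF W] A])
  also have "(\<lambda>h. \<Sum>b\<in>Basis. (W x \<bullet> b) *\<^sub>R A' h b + (W' h \<bullet> b) *\<^sub>R A x b)
      = (\<lambda>h. A' h (W x) + A x (W' h))"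
    by (simp only: sum.distrib linear_sum_Basis[OF linA', of _ "W x"]
        linear_sum_Basis[OF lin[OF \<open>x \<in> S\<close>], of "W' _"])
  finally show ?thesis
    by (rule has_derivative_transform_within_open[OF _ assms(1,2)])
      (rule linear_sum_Basis[OF lin, symmetric])
qed


section \<open>Symmetry of second derivatives\<close>

text \<open>The mean value theorem, applied first along \<open>u\<close> and then along \<open>v\<close>.\<close>

lemma second_difference_eq_mixed_derivative:
  fixes f :: "'e::real_normed_vector \<Rightarrow> real"
  assumes f: "smooth_on S f" and h: "h > 0"
    and sub: "\<And>s t. 0 \<le> s \<Longrightarrow> s \<le> h \<Longrightarrow> 0 \<le> t \<Longrightarrow> t \<le> h \<Longrightarrow> x + s *\<^sub>R u + t *\<^sub>R v \<in> S"
  obtains s t where "0 < s" "s < h" "0 < t" "t < h"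
    "f (x + h *\<^sub>R u + h *\<^sub>R v) - f (x + h *\<^sub>R u) - f (x + h *\<^sub>R v) + f x =
      h^2 * frechet_derivative (\<lambda>y. frechet_derivative f (at y) u) (at (x + s *\<^sub>R u + t *\<^sub>R v)) v"
proof -
  let ?D = "\<lambda>y. frechet_derivative f (at y) u"
  define \<phi> where "\<phi> s = f (x + s *\<^sub>R u + h *\<^sub>R v) - f (x + s *\<^sub>R u + 0 *\<^sub>R v)" for s
  have line: "((\<lambda>s. g (x + s *\<^sub>R u + t *\<^sub>R v)) has_derivative
      (\<lambda>k. k * frechet_derivative g (at (x + s *\<^sub>R u + t *\<^sub>R v)) u)) (at s)"
    "((\<lambda>t. g (x + s *\<^sub>R u + t *\<^sub>R v)) has_derivative
      (\<lambda>k. k * frechet_derivative g (at (x + s *\<^sub>R u + t *\<^sub>R v)) v)) (at t)"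
    if st: "0 \<le> s" "s \<le> h" "0 \<le> t" "t \<le> h" and g: "smooth_on S g" for s t and g :: "'e \<Rightarrow> real"
  proof -
    have gd: "(g has_derivative frechet_derivative g (at (x + s *\<^sub>R u + t *\<^sub>R v))) (at (x + s *\<^sub>R u + t *\<^sub>R v))"
      using g sub st smooth_on_has_derivative by blast
    note l = linear_cmul[OF has_derivative_linear[OF gd]]
    have "((\<lambda>s. x + s *\<^sub>R u + t *\<^sub>R v) has_derivative (\<lambda>k. k *\<^sub>R u)) (at s)"
      by (auto intro!: derivative_eq_intros)
    from has_derivative_compose[OF this gd]
    show "((\<lambda>s. g (x + s *\<^sub>R u + t *\<^sub>R v)) has_derivative
      (\<lambda>k. k * frechet_derivative g (at (x + s *\<^sub>R u + t *\<^sub>R v)) u)) (at s)" by (simp add: l)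
    have "((\<lambda>t. x + s *\<^sub>R u + t *\<^sub>R v) has_derivative (\<lambda>k. k *\<^sub>R v)) (at t)"
      by (auto intro!: derivative_eq_intros)
    from has_derivative_compose[OF this gd]
    show "((\<lambda>t. g (x + s *\<^sub>R u + t *\<^sub>R v)) has_derivative
      (\<lambda>k. k * frechet_derivative g (at (x + s *\<^sub>R u + t *\<^sub>R v)) v)) (at t)" by (simp add: l)
  qed
  have "\<exists>s\<in>{0<..<h}. \<phi> h - \<phi> 0 =
      (h - 0) * ?D (x + s *\<^sub>R u + h *\<^sub>R v) - (h - 0) * ?D (x + s *\<^sub>R u + 0 *\<^sub>R v)"
  proof (rule mvt_simple[OF h])
    fix s assume s: "0 \<le> s" "s \<le> h"
    show "(\<phi> has_derivative (\<lambda>k. k * ?D (x + s *\<^sub>R u + h *\<^sub>R v) - k * ?D (x + s *\<^sub>R u + 0 *\<^sub>R v)))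
        (at s within {0..h})"
      unfolding \<phi>_def
      by (rule has_derivative_at_withinI, rule has_derivative_diff)
        (rule line(1)[OF s _ _ f]; use h in simp)+
  qed
  then obtain s where s: "0 < s" "s < h"
    "\<phi> h - \<phi> 0 = h * (?D (x + s *\<^sub>R u + h *\<^sub>R v) - ?D (x + s *\<^sub>R u + 0 *\<^sub>R v))"
    by (auto simp: algebra_simps)
  have "\<exists>t\<in>{0<..<h}. ?D (x + s *\<^sub>R u + h *\<^sub>R v) - ?D (x + s *\<^sub>R u + 0 *\<^sub>R v) =
      (h - 0) * frechet_derivative ?D (at (x + s *\<^sub>R u + t *\<^sub>R v)) v"
  proof (rule mvt_simple[OF h])
    fix t assume t: "0 \<le> t" "t \<le> h"
    show "((\<lambda>t. ?D (x + s *\<^sub>R u + t *\<^sub>R v)) has_derivative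
        (\<lambda>k. k * frechet_derivative ?D (at (x + s *\<^sub>R u + t *\<^sub>R v)) v)) (at t within {0..h})"
      by (rule has_derivative_at_withinI,
          rule line(2)[OF _ _ t smooth_on_frechet_derivative[OF f]]) (use s in simp_all)
  qed
  then obtain t where "0 < t" "t < h"
    "?D (x + s *\<^sub>R u + h *\<^sub>R v) - ?D (x + s *\<^sub>R u + 0 *\<^sub>R v) =
      h * frechet_derivative ?D (at (x + s *\<^sub>R u + t *\<^sub>R v)) v" by auto
  with s that show ?thesis by (simp add: \<phi>_def power2_eq_square algebra_simps)
qed

text \<open>The second difference is symmetric in \<open>u\<close> and \<open>v\<close>, so a value of one mixed derivative equals a
  value of the other at points arbitrarily close to \<open>x\<close>; continuity does the rest.\<close>

lemma second_derivative_symmetric_real: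
  fixes f :: "'e::real_normed_vector \<Rightarrow> real"
  assumes f: "smooth_on S f" and S: "open S" "x \<in> S"
  shows "frechet_derivative (\<lambda>y. frechet_derivative f (at y) u) (at x) v
       = frechet_derivative (\<lambda>y. frechet_derivative f (at y) v) (at x) u"
proof -
  let ?D = "\<lambda>u v y. frechet_derivative (\<lambda>y. frechet_derivative f (at y) u) (at y) v"
  have bound: "\<bar>?D u v x - ?D v u x\<bar> \<le> e" if e: "e > 0" for e
  proof -
    have cont: "\<exists>d>0. \<forall>y. dist y x < d \<longrightarrow> dist (?D u v y) (?D u v x) < e / 2" for u v
    proof -
      have "isCont (?D u v) x"
        using smooth_on_continuous_on[OF smooth_on_frechet_derivative[OF smooth_on_frechet_derivative[OF f]]] S
        by (simp add: continuous_on_eq_continuous_at)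
      then show ?thesis using half_gt_zero[OF e] unfolding continuous_at_eps_delta by blast
    qed
    obtain d1 where d1: "d1 > 0" "\<And>y. dist y x < d1 \<Longrightarrow> dist (?D u v y) (?D u v x) < e / 2"
      using cont[of u v] by auto
    obtain d2 where d2: "d2 > 0" "\<And>y. dist y x < d2 \<Longrightarrow> dist (?D v u y) (?D v u x) < e / 2"
      using cont[of v u] by auto
    obtain d3 where d3: "d3 > 0" "\<And>y. dist y x < d3 \<Longrightarrow> y \<in> S"
      using S open_dist by blast
    define d where "d = min d1 (min d2 d3)"
    have d: "d > 0" using d1 d2 d3 by (simp add: d_def)
    \<comment> \<open>small enough that the whole parallelogram with sides \<open>h u\<close> and \<open>h v\<close> lies within \<open>d\<close> of \<open>x\<close>\<close>
    define h where "h = d / (2 * (norm u + norm v + 1))"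
    have h: "h > 0" using d by (simp add: h_def add_nonneg_pos)
    have near: "dist (x + s *\<^sub>R u + t *\<^sub>R v) x < d" if "0 \<le> s" "s \<le> h" "0 \<le> t" "t \<le> h" for s t
    proof -
      have "norm (s *\<^sub>R u + t *\<^sub>R v) \<le> h * norm u + h * norm v"
        using that by (intro norm_triangle_le add_mono) (auto intro: mult_right_mono)
      also have "\<dots> = h * (norm u + norm v)" by (simp add: algebra_simps)
      also have "\<dots> < h * (2 * (norm u + norm v + 1))"
      proof (rule mult_strict_left_mono[OF _ h])
        show "norm u + norm v < 2 * (norm u + norm v + 1)"
          using norm_ge_zero[of u] norm_ge_zero[of v] unfolding distrib_left by linarith
      qed
      also have "\<dots> = d" by (simp add: h_def add_nonneg_eq_0_iff)
      finally show ?thesis by (simp add: dist_norm add.assoc)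
    qed
    have near': "dist (x + s *\<^sub>R v + t *\<^sub>R u) x < d" if "0 \<le> s" "s \<le> h" "0 \<le> t" "t \<le> h" for s t
      using near[OF that(3,4,1,2)] by (simp add: algebra_simps)
    obtain s t where st: "0 < s" "s < h" "0 < t" "t < h"
      "f (x + h *\<^sub>R u + h *\<^sub>R v) - f (x + h *\<^sub>R u) - f (x + h *\<^sub>R v) + f x =
        h^2 * ?D u v (x + s *\<^sub>R u + t *\<^sub>R v)"
      by (rule second_difference_eq_mixed_derivative[OF f h]) (use near d3 d_def in auto)
    obtain s' t' where st': "0 < s'" "s' < h" "0 < t'" "t' < h"
      "f (x + h *\<^sub>R v + h *\<^sub>R u) - f (x + h *\<^sub>R v) - f (x + h *\<^sub>R u) + f x =
        h^2 * ?D v u (x + s' *\<^sub>R v + t' *\<^sub>R u)"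
      by (rule second_difference_eq_mixed_derivative[OF f h]) (use near' d3 d_def in auto)
    have swap: "x + h *\<^sub>R v + h *\<^sub>R u = x + h *\<^sub>R u + h *\<^sub>R v"
      by simp
    have "h^2 * ?D u v (x + s *\<^sub>R u + t *\<^sub>R v) = h^2 * ?D v u (x + s' *\<^sub>R v + t' *\<^sub>R u)"
      using st(5) st'(5)[unfolded swap] by linarith
    then have "?D u v (x + s *\<^sub>R u + t *\<^sub>R v) = ?D v u (x + s' *\<^sub>R v + t' *\<^sub>R u)"
      using h by simp
    moreover have "dist (?D u v (x + s *\<^sub>R u + t *\<^sub>R v)) (?D u v x) < e / 2"
      using d1(2) near[of s t] st by (simp add: d_def)
    moreover have "dist (?D v u (x + s' *\<^sub>R v + t' *\<^sub>R u)) (?D v u x) < e / 2"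
      using d2(2) near'[of s' t'] st' by (simp add: d_def)
    ultimately have "dist (?D u v x) (?D v u x) < e"
      using dist_triangle_half_r[of "?D u v (x + s *\<^sub>R u + t *\<^sub>R v)"] by simp
    then show ?thesis by (simp add: dist_real_def)
  qed
  have "\<not> 0 < \<bar>?D u v x - ?D v u x\<bar>"
    using bound[of "\<bar>?D u v x - ?D v u x\<bar> / 2"] by fastforce
  then show ?thesis by simp
qed

lemma second_derivative_symmetric:
  fixes f :: "'e::real_normed_vector \<Rightarrow> 'f::euclidean_space"
  assumes f: "smooth_on S f" and S: "open S" "x \<in> S"
  shows "frechet_derivative (\<lambda>y. frechet_derivative f (at y) u) (at x) v
       = frechet_derivative (\<lambda>y. frechet_derivative f (at y) v) (at x) u"
proof (rule euclidean_eqI)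
  fix b :: 'f
  have comp: "frechet_derivative (\<lambda>y. g y \<bullet> b) (at z) = (\<lambda>v. frechet_derivative g (at z) v \<bullet> b)"
    if "smooth_on S g" "z \<in> S" for g :: "'e \<Rightarrow> 'f" and z
    by (intro frechet_derivative_eqI has_derivative_inner_left smooth_on_has_derivative[OF that])
  have twice: "frechet_derivative (\<lambda>y. frechet_derivative f (at y) u) (at x) v \<bullet> b
      = frechet_derivative (\<lambda>y. frechet_derivative (\<lambda>y. f y \<bullet> b) (at y) u) (at x) v" for u v
  proof -
    have "((\<lambda>y. frechet_derivative f (at y) u \<bullet> b) has_derivative
        (\<lambda>v. frechet_derivative (\<lambda>y. frechet_derivative f (at y) u) (at x) v \<bullet> b)) (at x)"
      by (intro has_derivative_inner_left smooth_on_has_derivative[OF _ S(2)]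
          smooth_on_frechet_derivative f)
    then have "((\<lambda>y. frechet_derivative (\<lambda>y. f y \<bullet> b) (at y) u) has_derivative
        (\<lambda>v. frechet_derivative (\<lambda>y. frechet_derivative f (at y) u) (at x) v \<bullet> b)) (at x)"
      by (rule has_derivative_transform_within_open[OF _ S]) (simp add: comp[OF f])
    then show ?thesis by (simp add: frechet_derivative_eqI)
  qed
  have "smooth_on S (\<lambda>y. f y \<bullet> b)"
    by (rule smooth_on_bounded_linear[OF bounded_linear_inner_left S(1) f])
  then show "frechet_derivative (\<lambda>y. frechet_derivative f (at y) u) (at x) v \<bullet> b
       = frechet_derivative (\<lambda>y. frechet_derivative f (at y) v) (at x) u \<bullet> b"
    unfolding twice by (rule second_derivative_symmetric_real[OF _ S])
qed


section \<open>The vector representing a linear form\<close>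

lemma inner_product_form_linear:
  assumes "inner_product_form g"
  shows "linear (g u)" "linear (\<lambda>w. g w u)"
  using assms unfolding inner_product_form_def bilinear_def by blast+

lemma inner_product_form_sym: "inner_product_form g \<Longrightarrow> g u v = g v u"
  unfolding inner_product_form_def by blast

lemma inner_product_form_eqI:
  assumes g: "inner_product_form g" and eq: "\<And>v. g w v = g w' v"
  shows "w = w'"
proof (rule ccontr)
  assume "w \<noteq> w'"
  then have "g (w - w') (w - w') > 0"
    using g unfolding inner_product_form_def by (metis right_minus_eq)
  moreover have "g (w - w') v = 0" for v
    using linear_diff[OF inner_product_form_linear(2)[OF g]] eq by simp
  ultimately show False by simp
qed

lemma sharp_eqI:
  assumes g: "inner_product_form g" and eq: "\<And>v. g w v = \<alpha> v"
  shows "sharp g \<alpha> = w"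
  unfolding sharp_def
proof (rule the_equality)
  show "\<forall>v. g w v = \<alpha> v" using eq by simp
  show "w' = w" if "\<forall>v. g w' v = \<alpha> v" for w'
    by (rule inner_product_form_eqI[OF g]) (use that eq in simp)
qed

text \<open>Lowering an index: \<open>w\<close> is sent to the vector whose components in the standard basis are \<open>g w b\<close>.\<close>

lemma lowered_vector:
  fixes g :: "'m::euclidean_space \<Rightarrow> 'm \<Rightarrow> real"
  assumes g: "inner_product_form g"
  shows "linear (\<lambda>w. \<Sum>b\<in>Basis. g w b *\<^sub>R b)" "inj (\<lambda>w. \<Sum>b\<in>Basis. g w b *\<^sub>R b)"
proof -
  let ?F = "\<lambda>w. \<Sum>b\<in>Basis. g w b *\<^sub>R b"
  note l = inner_product_form_linear(2)[OF g]
  show lin: "linear ?F"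
    by (rule linearI)
      (simp_all add: linear_add[OF l] linear_cmul[OF l] scaleR_add_left sum.distrib scaleR_sum_right)
  show "inj ?F"
  proof (rule injI)
    fix w w' assume eq: "?F w = ?F w'"
    have "g w b = g w' b" if "b \<in> Basis" for b
    proof -
      have "?F w \<bullet> b = ?F w' \<bullet> b" using eq by simp
      then show ?thesis using that by simp
    qed
    then have "g w = g w'"
      by (rule linear_eq_stdbasis[OF inner_product_form_linear(1)[OF g] inner_product_form_linear(1)[OF g]])
    then show "w = w'" using inner_product_form_eqI[OF g, of w w'] by simp
  qed
qed

lemma sharp_works:
  fixes g :: "'m::euclidean_space \<Rightarrow> 'm \<Rightarrow> real"
  assumes g: "inner_product_form g" and \<alpha>: "linear \<alpha>"
  shows "g (sharp g \<alpha>) v = \<alpha> v"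
proof -
  have surj: "surj (\<lambda>w. \<Sum>b\<in>Basis. g w b *\<^sub>R b)"
    using lowered_vector[OF g] by (rule linear_injective_imp_surjective) (rule refl)
  then obtain w where w: "(\<Sum>b\<in>Basis. g w b *\<^sub>R b) = (\<Sum>b\<in>Basis. \<alpha> b *\<^sub>R b)"
    using surjD[OF surj, of "\<Sum>b\<in>Basis. \<alpha> b *\<^sub>R b"] by auto
  have "g w b = \<alpha> b" if "b \<in> Basis" for b
  proof -
    have "(\<Sum>b\<in>Basis. g w b *\<^sub>R b) \<bullet> b = (\<Sum>b\<in>Basis. \<alpha> b *\<^sub>R b) \<bullet> b" using w by simp
    then show ?thesis using that by simp
  qed
  then have "g w = \<alpha>"
    by (rule linear_eq_stdbasis[OF inner_product_form_linear(1)[OF g] \<alpha>])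
  then have "g w v = \<alpha> v" for v by simp
  moreover from this have "sharp g \<alpha> = w" by (rule sharp_eqI[OF g])
  ultimately show ?thesis by simp
qed

lemma sharp_lincomb:
  fixes g :: "'m::euclidean_space \<Rightarrow> 'm \<Rightarrow> real"
  assumes g: "inner_product_form g" and "linear \<alpha>" "linear \<beta>"
  shows "sharp g (\<lambda>v. a * \<alpha> v + b * \<beta> v) = a *\<^sub>R sharp g \<alpha> + b *\<^sub>R sharp g \<beta>"
proof (rule sharp_eqI[OF g])
  note l = inner_product_form_linear(2)[OF g]
  show "g (a *\<^sub>R sharp g \<alpha> + b *\<^sub>R sharp g \<beta>) v = a * \<alpha> v + b * \<beta> v" for v
    by (simp add: linear_add[OF l] linear_cmul[OF l] sharp_works[OF g assms(2)] sharp_works[OF g assms(3)])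
qed

text \<open>An error that is \<open>o(\<parallel>t\<parallel>)\<close> is \<open>o(\<parallel>y - x\<parallel>)\<close>, because \<open>t\<close> is differentiable and vanishes at \<open>x\<close>.\<close>

lemma has_derivative_relative_error:
  fixes t e :: "'e::real_normed_vector \<Rightarrow> 'f::real_normed_vector"
  assumes t: "(t has_derivative t') (at x)" and t0: "t x = 0" and e0: "e x = 0"
    and \<rho>: "(\<rho> \<longlongrightarrow> 0) (at x)"
    and err: "\<forall>\<^sub>F y in at x. norm (e y - t y) \<le> \<rho> y * norm (t y)"
    and \<rho>0: "\<And>y. \<rho> y \<ge> 0"
  shows "(e has_derivative t') (at x)"
proof -
  obtain K where K: "\<And>h. norm (t' h) \<le> norm h * K"
    using bounded_linear.bounded[OF has_derivative_bounded_linear[OF t]] by blast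
  define a where "a y = norm (t y - t x - t' (y - x)) / norm (y - x)" for y
  have a: "(a \<longlongrightarrow> 0) (at x)"
    using t unfolding a_def has_derivative_iff_norm by blast
  have "((\<lambda>y. e y - t y) has_derivative (\<lambda>h. 0)) (at x)"
    unfolding has_derivative_iff_norm
  proof (intro conjI bounded_linear_zero)
    have lim: "((\<lambda>y. \<rho> y * (a y + K)) \<longlongrightarrow> 0) (at x)"
      using tendsto_mult[OF \<rho> tendsto_add[OF a tendsto_const[of K]]] by simp
    show "((\<lambda>y. norm (e y - t y - (e x - t x) - 0) / norm (y - x)) \<longlongrightarrow> 0) (at x)"
    proof (rule tendsto_sandwich[OF _ _ tendsto_const lim])
      show "\<forall>\<^sub>F y in at x. 0 \<le> norm (e y - t y - (e x - t x) - 0) / norm (y - x)" by simp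
      have "\<forall>\<^sub>F y in at x. y \<noteq> x" by (simp add: eventually_at_filter)
      with err show "\<forall>\<^sub>F y in at x. norm (e y - t y - (e x - t x) - 0) / norm (y - x) \<le> \<rho> y * (a y + K)"
      proof eventually_elim
        case (elim y)
        have "norm (t y) \<le> norm (t y - t' (y - x)) + norm (t' (y - x))"
          by (metis diff_add_cancel norm_triangle_ineq)
        also have "\<dots> \<le> norm (t y - t' (y - x)) + norm (y - x) * K" using K by simp
        also have "\<dots> = (a y + K) * norm (y - x)"
          using elim by (simp add: a_def t0 field_simps)
        finally have "\<rho> y * norm (t y) \<le> \<rho> y * ((a y + K) * norm (y - x))"
          using \<rho>0 by (rule mult_left_mono)
        with elim have "norm (e y - t y) \<le> (\<rho> y * (a y + K)) * norm (y - x)" by simp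
        then show ?case using elim t0 e0 by (simp add: divide_le_eq)
      qed
    qed
  qed
  from has_derivative_add[OF this t] show ?thesis by simp
qed

text \<open>With \<open>F y\<close> the linear map that lowers an index with respect to \<open>G y\<close>, the vector \<open>w y\<close> solves
  \<open>F y (w y) = R y\<close>. If \<open>M\<close> inverts \<open>F x\<close>, then \<open>e y = w y - w x\<close> satisfies
  \<open>e y = M (R y - F y (w x)) - M (F y (e y) - F x (e y))\<close>, and the last term is of smaller order than
  \<open>e y\<close>. So \<open>e\<close> has the same derivative as the explicit term.\<close>

lemma differentiable_sharp:
  fixes G :: "'e::real_normed_vector \<Rightarrow> 'm::euclidean_space \<Rightarrow> 'm \<Rightarrow> real"
  assumes S: "open S" "x \<in> S" and g: "\<And>y. y \<in> S \<Longrightarrow> inner_product_form (G y)"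
    and dG: "\<And>u v. (\<lambda>y. G y u v) differentiable (at x)"
    and \<alpha>: "\<And>y. y \<in> S \<Longrightarrow> linear (\<alpha> y)" and d\<alpha>: "\<And>v. (\<lambda>y. \<alpha> y v) differentiable (at x)"
  shows "(\<lambda>y. sharp (G y) (\<alpha> y)) differentiable (at x)"
proof -
  define w where "w y = sharp (G y) (\<alpha> y)" for y
  define F where "F y v = (\<Sum>b\<in>Basis. G y v b *\<^sub>R b)" for y v
  define R where "R y = (\<Sum>b\<in>Basis. \<alpha> y b *\<^sub>R b)" for y
  have F: "linear (F y)" "inj (F y)" if "y \<in> S" for y
    using lowered_vector[OF g[OF that]] unfolding F_def by simp_all
  have Fw: "F y (w y) = R y" if "y \<in> S" for y
    unfolding F_def R_def w_def by (simp add: sharp_works[OF g \<alpha>] that)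
  have dF: "(\<lambda>y. F y v) differentiable (at x)" for v
    unfolding F_def by (intro differentiable_sum finite_Basis ballI differentiable_scaleR dG differentiable_const)
  have dR: "R differentiable (at x)"
    unfolding R_def by (intro differentiable_sum finite_Basis ballI differentiable_scaleR d\<alpha> differentiable_const)
  obtain M where M: "linear M" "\<And>v. M (F x v) = v"
    using linear_injective_left_inverse[OF F[OF S(2)]] by (metis comp_apply id_apply)
  have bM: "bounded_linear M" using M(1) by (simp add: linear_conv_bounded_linear)
  obtain K where K: "K > 0" "\<And>v. norm (M v) \<le> norm v * K"
    using bounded_linear.pos_bounded[OF bM] by blast
  define e where "e y = w y - w x" for y
  define t where "t y = M (R y - F y (w x))" for y
  define \<rho> where "\<rho> y = K * (\<Sum>c\<in>Basis. norm (F y c - F x c))" for y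
  have \<rho>0: "\<rho> y \<ge> 0" for y using K(1) by (simp add: \<rho>_def sum_nonneg)
  have op: "norm (M (F y v - F x v)) \<le> \<rho> y * norm v" if y: "y \<in> S" for y v
  proof -
    have "F y v - F x v = (\<Sum>c\<in>Basis. (v \<bullet> c) *\<^sub>R (F y c - F x c))"
      by (simp only: linear_sum_Basis[OF F(1)[OF y], of v] linear_sum_Basis[OF F(1)[OF S(2)], of v]
          scaleR_diff_right sum_subtractf)
    then have "norm (F y v - F x v) \<le> (\<Sum>c\<in>Basis. norm v * norm (F y c - F x c))"
      by (auto intro!: sum_norm_le mult_right_mono Basis_le_norm)
    then have "norm (F y v - F x v) * K \<le> (\<Sum>c\<in>Basis. norm v * norm (F y c - F x c)) * K"
      using K(1) by (intro mult_right_mono) auto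
    with K(2)[of "F y v - F x v"] show ?thesis
      by (simp add: \<rho>_def sum_distrib_left[symmetric] mult_ac)
  qed
  have et: "e y - t y = - M (F y (e y) - F x (e y))" if y: "y \<in> S" for y
  proof -
    have "t y = M (F y (e y))"
      by (simp add: t_def e_def linear_diff[OF F(1)[OF y]] Fw[OF y])
    then show ?thesis by (simp add: linear_diff[OF M(1)] M(2))
  qed
  have "((\<lambda>y. \<Sum>c\<in>Basis. norm (F y c - F x c)) \<longlongrightarrow> (\<Sum>c\<in>Basis. norm (F x c - F x c))) (at x)"
  proof (intro tendsto_sum tendsto_norm tendsto_diff tendsto_const)
    show "((\<lambda>y. F y c) \<longlongrightarrow> F x c) (at x)" for c
      using differentiable_imp_continuous_within[OF dF[of c]] by (simp add: continuous_within)
  qed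
  from tendsto_mult[OF tendsto_const[of K] this] have \<rho>: "(\<rho> \<longlongrightarrow> 0) (at x)"
    unfolding \<rho>_def by simp
  have inS: "\<forall>\<^sub>F y in at x. y \<in> S" by (rule eventually_at_in_open'[OF S])
  have small: "\<forall>\<^sub>F y in at x. \<rho> y < 1/2" using order_tendstoD(2)[OF \<rho>, of "1/2"] by simp
  have err: "\<forall>\<^sub>F y in at x. norm (e y - t y) \<le> (2 * \<rho> y) * norm (t y)"
    using inS small
  proof eventually_elim
    case (elim y)
    have 1: "norm (e y - t y) \<le> \<rho> y * norm (e y)"
      using op[OF elim(1), of "e y"] et[OF elim(1)] by simp
    also have "\<dots> \<le> 1/2 * norm (e y)" using elim(2) by (intro mult_right_mono) auto
    finally have "norm (e y - t y) \<le> norm (e y) / 2" by simp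
    moreover have "norm (e y) \<le> norm (t y) + norm (e y - t y)"
      using norm_triangle_sub by blast
    ultimately have "norm (e y) \<le> 2 * norm (t y)" by linarith
    from mult_left_mono[OF this \<rho>0[of y]] 1 show ?case by simp
  qed
  have "t differentiable (at x)"
    unfolding t_def
    by (rule differentiable_chain_at[unfolded o_def, where f = "\<lambda>y. R y - F y (w x)" and g = M])
      (intro differentiable_diff dR dF bounded_linear_imp_differentiable bM)+
  then obtain t' where t': "(t has_derivative t') (at x)" unfolding differentiable_def by blast
  have "t x = 0" by (simp add: t_def Fw[OF S(2)] linear_0[OF M(1)])
  then have "(e has_derivative t') (at x)"
    by (intro has_derivative_relative_error[OF t' _ _ _ err])
      (use tendsto_mult[OF tendsto_const[of 2] \<rho>] \<rho>0 in \<open>simp_all add: e_def\<close>)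
  from has_derivative_add[OF this has_derivative_const[of "w x"]]
  show ?thesis unfolding differentiable_def e_def w_def by auto
qed


section \<open>Gradient and divergence in a chart\<close>

text \<open>\<open>G\<close> is the coordinate expression of a smooth Riemannian metric on the open set \<open>S\<close>.\<close>

definition riemannian_metric_on :: "'m::euclidean_space set \<Rightarrow> ('m \<Rightarrow> 'm \<Rightarrow> 'm \<Rightarrow> real) \<Rightarrow> bool" where
  "riemannian_metric_on S G \<longleftrightarrow>
     open S \<and> (\<forall>x\<in>S. inner_product_form (G x)) \<and> (\<forall>u v. smooth_on S (\<lambda>x. G x u v))"

lemma riemannian_metric_onD:
  assumes "riemannian_metric_on S G"
  shows "open S" "x \<in> S \<Longrightarrow> inner_product_form (G x)" "smooth_on S (\<lambda>x. G x u v)"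
  using assms unfolding riemannian_metric_on_def by blast+

lemma local_gradient_works:
  assumes "inner_product_form (G x)" "f differentiable (at x)"
  shows "G x (local_gradient G f x) v = frechet_derivative f (at x) v"
  unfolding local_gradient_def
  by (rule sharp_works[OF assms(1) linear_frechet_derivative[OF assms(2)]])

lemma differentiable_local_gradient:
  assumes G: "riemannian_metric_on S G" and f: "smooth_on S f" and x: "x \<in> S"
  shows "local_gradient G f differentiable (at x)"
  unfolding local_gradient_def
proof (rule differentiable_sharp[OF riemannian_metric_onD(1)[OF G] x])
  show "inner_product_form (G y)" if "y \<in> S" for y
    using riemannian_metric_onD(2)[OF G that] .
  show "(\<lambda>y. G y u v) differentiable (at x)" for u v
    using smooth_on_differentiable[OF riemannian_metric_onD(3)[OF G] x] .
  show "linear (frechet_derivative f (at y))" if "y \<in> S" for y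
    using linear_frechet_derivative[OF smooth_on_differentiable[OF f that]] .
  show "(\<lambda>y. frechet_derivative f (at y) v) differentiable (at x)" for v
    using smooth_on_differentiable[OF smooth_on_frechet_derivative[OF f] x] .
qed

text \<open>The Koszul formula for constant vector fields: the Christoffel symbol of the first kind, that is
  \<open>G x (\<Gamma> x u v) w\<close>.\<close>

definition koszul_form ::
  "('m::euclidean_space \<Rightarrow> 'm \<Rightarrow> 'm \<Rightarrow> real) \<Rightarrow> 'm \<Rightarrow> 'm \<Rightarrow> 'm \<Rightarrow> 'm \<Rightarrow> real" where
  "koszul_form G x u v w =
     (frechet_derivative (\<lambda>y. G y v w) (at x) u
      + frechet_derivative (\<lambda>y. G y u w) (at x) v
      - frechet_derivative (\<lambda>y. G y u v) (at x) w) / 2"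

lemma christoffel_koszul: "christoffel G x u v = sharp (G x) (koszul_form G x u v)"
  unfolding christoffel_def koszul_form_def ..

lemma linear_metric_derivative:
  assumes G: "riemannian_metric_on S G" and x: "x \<in> S"
  shows "linear (\<lambda>w. frechet_derivative (\<lambda>y. G y v w) (at x) u)"
    and "linear (\<lambda>w. frechet_derivative (\<lambda>y. G y w v) (at x) u)"
    and "linear (frechet_derivative (\<lambda>y. G y u v) (at x))"
proof -
  note d = smooth_on_has_derivative[OF riemannian_metric_onD(3)[OF G] x]
  show "linear (\<lambda>w. frechet_derivative (\<lambda>y. G y v w) (at x) u)"
    by (rule linear_has_derivative_family[OF riemannian_metric_onD(1)[OF G] x
          inner_product_form_linear(1)[OF riemannian_metric_onD(2)[OF G]] d])
  show "linear (\<lambda>w. frechet_derivative (\<lambda>y. G y w v) (at x) u)"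
    by (rule linear_has_derivative_family[OF riemannian_metric_onD(1)[OF G] x
          inner_product_form_linear(2)[OF riemannian_metric_onD(2)[OF G]] d])
  show "linear (frechet_derivative (\<lambda>y. G y u v) (at x))"
    using has_derivative_linear[OF d] .
qed

lemma linear_koszul_form:
  assumes G: "riemannian_metric_on S G" and x: "x \<in> S"
  shows "linear (koszul_form G x u v)" "linear (\<lambda>u. koszul_form G x u v w)"
proof -
  note l = linear_metric_derivative[OF assms]
  show "linear (koszul_form G x u v)"
    unfolding koszul_form_def
    by (rule linearI)
      (simp_all add: linear_add[OF l(1)] linear_cmul[OF l(1)]
        linear_add[OF l(3)] linear_cmul[OF l(3)] field_simps)
  show "linear (\<lambda>u. koszul_form G x u v w)"
    unfolding koszul_form_def
    by (rule linearI)
      (simp_all add: linear_add[OF l(2)] linear_cmul[OF l(2)]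
        linear_add[OF l(3)] linear_cmul[OF l(3)] field_simps)
qed

lemma christoffel_works:
  assumes G: "riemannian_metric_on S G" and x: "x \<in> S"
  shows "G x (christoffel G x u v) w = koszul_form G x u v w"
  unfolding christoffel_koszul
  by (rule sharp_works[OF riemannian_metric_onD(2)[OF G x] linear_koszul_form(1)[OF assms]])

lemma linear_christoffel:
  assumes G: "riemannian_metric_on S G" and x: "x \<in> S"
  shows "linear (\<lambda>u. christoffel G x u v)"
proof (rule linearI)
  note g = riemannian_metric_onD(2)[OF G x]
  note l = linear_koszul_form(2)[OF assms]
  show "christoffel G x (u + u') v = christoffel G x u v + christoffel G x u' v" for u u'
  proof -
    have "koszul_form G x (u + u') v = (\<lambda>w. 1 * koszul_form G x u v w + 1 * koszul_form G x u' v w)"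
      by (rule ext) (simp add: linear_add[OF l])
    then show ?thesis
      unfolding christoffel_koszul
      using sharp_lincomb[OF g linear_koszul_form(1)[OF assms] linear_koszul_form(1)[OF assms],
          of 1 u v 1 u' v]
      by (simp only: scaleR_one)
  qed
  show "christoffel G x (c *\<^sub>R u) v = c *\<^sub>R christoffel G x u v" for c u
  proof -
    have "koszul_form G x (c *\<^sub>R u) v = (\<lambda>w. c * koszul_form G x u v w + 0 * koszul_form G x u v w)"
      by (rule ext) (simp add: linear_cmul[OF l])
    then show ?thesis
      unfolding christoffel_koszul
      using sharp_lincomb[OF g linear_koszul_form(1)[OF assms] linear_koszul_form(1)[OF assms],
          of c u v 0 u v]
      by (simp only: scaleR_zero_left add_0_right)
  qed
qed

text \<open>Torsion-freeness: the Koszul form is symmetric in \<open>u\<close> and \<open>v\<close>.\<close>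

lemma linear_christoffel_right:
  assumes G: "riemannian_metric_on S G" and x: "x \<in> S"
  shows "linear (christoffel G x u)"
proof -
  have "koszul_form G x u v = koszul_form G x v u" for v
  proof
    fix w
    have "((\<lambda>y. G y u v) has_derivative frechet_derivative (\<lambda>y. G y v u) (at x)) (at x)"
      by (rule has_derivative_transform_within_open[OF
            smooth_on_has_derivative[OF riemannian_metric_onD(3)[OF G] x]
            riemannian_metric_onD(1)[OF G] x])
        (rule inner_product_form_sym[OF riemannian_metric_onD(2)[OF G]])
    then have "frechet_derivative (\<lambda>y. G y u v) (at x) = frechet_derivative (\<lambda>y. G y v u) (at x)"
      by (rule frechet_derivative_eqI)
    then show "koszul_form G x u v w = koszul_form G x v u w"
      unfolding koszul_form_def by simp
  qed
  then have "christoffel G x u = (\<lambda>v. christoffel G x v u)"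
    unfolding christoffel_koszul by metis
  then show ?thesis using linear_christoffel[OF assms, of u] by simp
qed

lemma linear_covariant_derivative:
  assumes "riemannian_metric_on S G" "x \<in> S" "X differentiable (at x)"
  shows "linear (covariant_derivative G X x)"
  unfolding covariant_derivative_def
  by (rule linear_compose_add[OF linear_frechet_derivative[OF assms(3)] linear_christoffel[OF assms(1,2)]])

text \<open>The Laplace-Beltrami operator in coordinates.\<close>

definition local_laplacian ::
  "('m::euclidean_space \<Rightarrow> 'm \<Rightarrow> 'm \<Rightarrow> real) \<Rightarrow> ('m \<Rightarrow> real) \<Rightarrow> 'm \<Rightarrow> real" where
  "local_laplacian G f = local_divergence G (local_gradient G f)"

lemma local_gradient_lincomb:
  assumes "inner_product_form (G x)" "f differentiable (at x)" "h differentiable (at x)"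
  shows "local_gradient G (\<lambda>y. a * f y + b * h y) x =
    a *\<^sub>R local_gradient G f x + b *\<^sub>R local_gradient G h x"
proof -
  have "frechet_derivative (\<lambda>y. a * f y + b * h y) (at x) =
      (\<lambda>v. a * frechet_derivative f (at x) v + b * frechet_derivative h (at x) v)"
    by (intro frechet_derivative_eqI has_derivative_add has_derivative_mult_right)
      (use assms in \<open>simp_all add: frechet_derivative_works\<close>)
  then show ?thesis
    unfolding local_gradient_def
    by (simp add: sharp_lincomb[OF assms(1) linear_frechet_derivative linear_frechet_derivative] assms(2,3))
qed

lemma local_divergence_cong:
  assumes "open S" "x \<in> S" "\<And>y. y \<in> S \<Longrightarrow> X y = Y y" "Y differentiable (at x)"
  shows "local_divergence G X x = local_divergence G Y x"
proof -
  have "(X has_derivative frechet_derivative Y (at x)) (at x)"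
    by (rule has_derivative_transform_within_open[of Y _ x UNIV S])
      (use assms in \<open>simp_all add: frechet_derivative_works\<close>)
  then have "frechet_derivative X (at x) = frechet_derivative Y (at x)"
    by (rule frechet_derivative_eqI)
  then show ?thesis
    by (simp add: local_divergence_def covariant_derivative_def assms)
qed

lemma local_divergence_lincomb:
  assumes G: "riemannian_metric_on S G" and x: "x \<in> S"
    and X: "X differentiable (at x)" and Y: "Y differentiable (at x)"
  shows "local_divergence G (\<lambda>y. a *\<^sub>R X y + b *\<^sub>R Y y) x =
    a * local_divergence G X x + b * local_divergence G Y x"
proof -
  have "frechet_derivative (\<lambda>y. a *\<^sub>R X y + b *\<^sub>R Y y) (at x) =
      (\<lambda>v. a *\<^sub>R frechet_derivative X (at x) v + b *\<^sub>R frechet_derivative Y (at x) v)"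
    by (intro frechet_derivative_eqI has_derivative_add has_derivative_scaleR_right)
      (use X Y in \<open>simp_all add: frechet_derivative_works\<close>)
  then have "covariant_derivative G (\<lambda>y. a *\<^sub>R X y + b *\<^sub>R Y y) x v =
      a *\<^sub>R covariant_derivative G X x v + b *\<^sub>R covariant_derivative G Y x v" for v
    unfolding covariant_derivative_def
    by (simp add: linear_add[OF linear_christoffel_right[OF G x]]
        linear_cmul[OF linear_christoffel_right[OF G x]] scaleR_add_right)
  then show ?thesis
    by (simp add: local_divergence_def inner_add_left sum.distrib sum_distrib_left)
qed

lemma local_laplacian_lincomb:
  assumes G: "riemannian_metric_on S G" and x: "x \<in> S"
    and f: "smooth_on S f" and h: "smooth_on S h"
  shows "local_laplacian G (\<lambda>y. a * f y + b * h y) x =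
    a * local_laplacian G f x + b * local_laplacian G h x"
proof -
  note d = differentiable_local_gradient[OF G f x] differentiable_local_gradient[OF G h x]
  have "local_laplacian G (\<lambda>y. a * f y + b * h y) x =
      local_divergence G (\<lambda>y. a *\<^sub>R local_gradient G f y + b *\<^sub>R local_gradient G h y) x"
    unfolding local_laplacian_def
  proof (rule local_divergence_cong[OF riemannian_metric_onD(1)[OF G] x])
    show "local_gradient G (\<lambda>y. a * f y + b * h y) y =
        a *\<^sub>R local_gradient G f y + b *\<^sub>R local_gradient G h y" if "y \<in> S" for y
      by (rule local_gradient_lincomb[of G y f h, OF riemannian_metric_onD(2)[OF G that]
            smooth_on_differentiable[OF f that] smooth_on_differentiable[OF h that]])
    show "(\<lambda>y. a *\<^sub>R local_gradient G f y + b *\<^sub>R local_gradient G h y) differentiable (at x)"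
      using d by (intro differentiable_add differentiable_scaleR differentiable_const)
  qed
  then show ?thesis
    unfolding local_divergence_lincomb[OF G x d] local_laplacian_def .
qed


section \<open>Invariance of the trace\<close>

lemma trace_commute:
  fixes P Q :: "'m::euclidean_space \<Rightarrow> 'm"
  assumes "linear P" "linear Q"
  shows "(\<Sum>b\<in>Basis. P (Q b) \<bullet> b) = (\<Sum>b\<in>Basis. Q (P b) \<bullet> b)"
proof -
  have expand: "(\<Sum>b\<in>Basis. A (B b) \<bullet> b) = (\<Sum>b\<in>Basis. \<Sum>c\<in>Basis. (B b \<bullet> c) * (A c \<bullet> b))"
    if "linear A" for A B :: "'m \<Rightarrow> 'm"
    by (rule sum.cong[OF refl]) (simp add: linear_sum_Basis[OF that, of "B _"] inner_sum_left)
  show ?thesis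
    unfolding expand[OF assms(1)] expand[OF assms(2)]
    by (subst sum.swap) (simp add: mult.commute)
qed

text \<open>The hypotheses say that \<open>B\<close> is the conjugate of \<open>A\<close> by \<open>D\<close>; an injective \<open>D\<close> is invertible here.\<close>

lemma trace_similar:
  fixes A B D :: "'m::euclidean_space \<Rightarrow> 'm"
  assumes "linear A" "linear B" "linear D" "inj D" "\<And>v. B (D v) = D (A v)"
  shows "(\<Sum>b\<in>Basis. B b \<bullet> b) = (\<Sum>b\<in>Basis. A b \<bullet> b)"
proof -
  obtain E where E: "linear E" "\<And>v. E (D v) = v"
    using linear_injective_left_inverse[OF assms(3,4)] by (metis comp_apply id_apply)
  have "surj D" using assms(3,4) by (rule linear_injective_imp_surjective) (rule refl)
  then have DE: "D (E v) = v" for v using E(2) surjD[of D v] by auto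
  have "(\<Sum>b\<in>Basis. B b \<bullet> b) = (\<Sum>b\<in>Basis. D (E (B b)) \<bullet> b)" by (simp add: DE)
  also have "\<dots> = (\<Sum>b\<in>Basis. E (B (D b)) \<bullet> b)"
    using trace_commute[OF assms(3) linear_compose[OF assms(2) E(1)]] by simp
  also have "\<dots> = (\<Sum>b\<in>Basis. A b \<bullet> b)" by (simp add: assms(5) E(2))
  finally show ?thesis .
qed


section \<open>Change of coordinates\<close>

text \<open>A smooth map \<open>T\<close> that pulls the metric \<open>H\<close> on \<open>V\<close> back to the metric \<open>G\<close> on \<open>U\<close>. It need not be
  injective; its derivative is invertible at every point because it preserves inner products.\<close>

locale isometric_change =
  fixes U V :: "'m::euclidean_space set" and T :: "'m \<Rightarrow> 'm"
    and G H :: "'m \<Rightarrow> 'm \<Rightarrow> 'm \<Rightarrow> real"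
  assumes G: "riemannian_metric_on U G" and H: "riemannian_metric_on V H"
    and T: "smooth_on U T" and TU: "x \<in> U \<Longrightarrow> T x \<in> V"
    and pullback: "x \<in> U \<Longrightarrow>
      G x u v = H (T x) (frechet_derivative T (at x) u) (frechet_derivative T (at x) v)"
begin

text \<open>The derivative of \<open>T\<close>, and its second derivative along \<open>u\<close> and \<open>v\<close> (\<open>v\<close> first).\<close>

abbreviation DT :: "'m \<Rightarrow> 'm \<Rightarrow> 'm" where
  "DT x \<equiv> frechet_derivative T (at x)"

abbreviation D2T :: "'m \<Rightarrow> 'm \<Rightarrow> 'm \<Rightarrow> 'm" where
  "D2T x u v \<equiv> frechet_derivative (\<lambda>y. DT y v) (at x) u"

lemma open_U: "open U" and open_V: "open V"
  using riemannian_metric_onD(1) G H by blast+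

lemma ipf_G: "x \<in> U \<Longrightarrow> inner_product_form (G x)"
  and ipf_H: "x \<in> U \<Longrightarrow> inner_product_form (H (T x))"
  using riemannian_metric_onD(2) G H TU by blast+

lemma linear_DT: "x \<in> U \<Longrightarrow> linear (DT x)"
  using linear_frechet_derivative smooth_on_differentiable[OF T] by blast

lemma inj_DT:
  assumes x: "x \<in> U" shows "inj (DT x)"
proof (rule injI)
  fix u v assume "DT x u = DT x v"
  then have "G x u w = G x v w" for w by (simp add: pullback[OF x])
  then show "u = v" by (rule inner_product_form_eqI[OF ipf_G[OF x]])
qed

lemma surj_DT:
  assumes x: "x \<in> U" obtains w where "DT x w = z"
proof -
  have "surj (DT x)"
    using linear_DT[OF x] inj_DT[OF x] by (rule linear_injective_imp_surjective) (rule refl)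
  from surjD[OF this, of z] that show ?thesis by metis
qed

lemma sharp_change:
  assumes x: "x \<in> U" and \<alpha>: "linear \<alpha>"
  shows "sharp (H (T x)) \<alpha> = DT x (sharp (G x) (\<lambda>v. \<alpha> (DT x v)))"
proof (rule sharp_eqI[OF ipf_H[OF x]])
  fix z
  obtain w where w: "DT x w = z" using surj_DT[OF x] .
  have "linear (\<lambda>v. \<alpha> (DT x v))"
    using linear_compose[OF linear_DT[OF x] \<alpha>] by (simp add: o_def)
  from sharp_works[OF ipf_G[OF x] this, of w]
  show "H (T x) (DT x (sharp (G x) (\<lambda>v. \<alpha> (DT x v)))) z = \<alpha> z"
    by (simp add: pullback[OF x] w)
qed

lemma local_gradient_change:
  assumes x: "x \<in> U" and f: "f differentiable (at (T x))" and fg: "\<And>y. y \<in> U \<Longrightarrow> g y = f (T y)"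
  shows "local_gradient H f (T x) = DT x (local_gradient G g x)"
proof -
  have "((\<lambda>y. f (T y)) has_derivative (\<lambda>v. frechet_derivative f (at (T x)) (DT x v))) (at x)"
    by (rule has_derivative_compose[OF smooth_on_has_derivative[OF T x]])
      (use f in \<open>simp add: frechet_derivative_works\<close>)
  then have "(g has_derivative (\<lambda>v. frechet_derivative f (at (T x)) (DT x v))) (at x)"
    by (rule has_derivative_transform_within_open[OF _ open_U x]) (simp add: fg)
  then show ?thesis
    unfolding local_gradient_def sharp_change[OF x linear_frechet_derivative[OF f]]
    by (simp add: frechet_derivative_eqI)
qed

lemma DT_has_derivative:
  assumes x: "x \<in> U" shows "((\<lambda>y. DT y v) has_derivative (\<lambda>h. D2T x h v)) (at x)"
  using smooth_on_has_derivative[OF smooth_on_frechet_derivative[OF T] x] .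

lemma D2T_sym: "x \<in> U \<Longrightarrow> D2T x u v = D2T x v u"
  by (rule second_derivative_symmetric[OF T open_U])

text \<open>The derivative of \<open>G y v w = H (T y) (DT y v) (DT y w)\<close> by the Leibniz rule.\<close>

lemma metric_derivative_change:
  assumes x: "x \<in> U"
  shows "frechet_derivative (\<lambda>y. G y v w) (at x) u =
    frechet_derivative (\<lambda>z. H z (DT x v) (DT x w)) (at (T x)) (DT x u)
    + H (T x) (DT x v) (D2T x u w) + H (T x) (D2T x u v) (DT x w)"
proof -
  have HT: "((\<lambda>y. H (T y) p q) has_derivative
      (\<lambda>h. frechet_derivative (\<lambda>z. H z p q) (at (T x)) (DT x h))) (at x)" for p q
    by (rule has_derivative_compose[OF smooth_on_has_derivative[OF T x]
          smooth_on_has_derivative[OF riemannian_metric_onD(3)[OF H] TU[OF x]]])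
  have inner: "((\<lambda>y. H (T y) p (DT y w)) has_derivative
      (\<lambda>h. frechet_derivative (\<lambda>z. H z p (DT x w)) (at (T x)) (DT x h) + H (T x) p (D2T x h w))) (at x)"
    for p
    by (rule has_derivative_linear_family[OF open_U x
          inner_product_form_linear(1)[OF ipf_H] HT DT_has_derivative[OF x]])
  have "((\<lambda>y. H (T y) (DT y v) (DT y w)) has_derivative
      (\<lambda>h. (frechet_derivative (\<lambda>z. H z (DT x v) (DT x w)) (at (T x)) (DT x h)
        + H (T x) (DT x v) (D2T x h w)) + H (T x) (D2T x h v) (DT x w))) (at x)"
    by (rule has_derivative_linear_family[where A = "\<lambda>y p. H (T y) p (DT y w)" and
          A' = "\<lambda>h p. frechet_derivative (\<lambda>z. H z p (DT x w)) (at (T x)) (DT x h) + H (T x) p (D2T x h w)",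
          OF open_U x inner_product_form_linear(2)[OF ipf_H] inner DT_has_derivative[OF x]])
  then have "((\<lambda>y. G y v w) has_derivative
      (\<lambda>h. (frechet_derivative (\<lambda>z. H z (DT x v) (DT x w)) (at (T x)) (DT x h)
        + H (T x) (DT x v) (D2T x h w)) + H (T x) (D2T x h v) (DT x w))) (at x)"
    by (rule has_derivative_transform_within_open[OF _ open_U x]) (simp add: pullback)
  then show ?thesis by (simp add: frechet_derivative_eqI)
qed

text \<open>By symmetry of \<open>D2T x\<close>, four of the six second-order terms of the Koszul formula cancel, and the
  other two coincide.\<close>

lemma koszul_form_change:
  assumes x: "x \<in> U"
  shows "koszul_form G x u v w =
    koszul_form H (T x) (DT x u) (DT x v) (DT x w) + H (T x) (D2T x u v) (DT x w)"
  unfolding koszul_form_def metric_derivative_change[OF x]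
    D2T_sym[OF x, of w] D2T_sym[OF x, of v u]
    inner_product_form_sym[OF ipf_H[OF x], of "DT x _" "D2T x _ _"]
  by (simp add: field_simps)

text \<open>The inhomogeneous transformation law of the Christoffel symbols.\<close>

lemma christoffel_change:
  assumes x: "x \<in> U"
  shows "DT x (christoffel G x u v) = christoffel H (T x) (DT x u) (DT x v) + D2T x u v"
proof (rule inner_product_form_eqI[OF ipf_H[OF x]])
  fix z
  obtain w where w: "z = DT x w" using surj_DT[OF x] by metis
  have "H (T x) (DT x (christoffel G x u v)) z = koszul_form G x u v w"
    unfolding w pullback[OF x, symmetric] by (rule christoffel_works[OF G x])
  also have "\<dots> = H (T x) (christoffel H (T x) (DT x u) (DT x v) + D2T x u v) z"
    by (simp add: koszul_form_change[OF x] christoffel_works[OF H TU[OF x]] w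
        linear_add[OF inner_product_form_linear(2)[OF ipf_H[OF x]]])
  finally show "H (T x) (DT x (christoffel G x u v)) z
      = H (T x) (christoffel H (T x) (DT x u) (DT x v) + D2T x u v) z" .
qed

text \<open>The second-order terms of \<open>DT y (Y y)\<close> and of the Christoffel symbols cancel, so covariant
  differentiation commutes with \<open>DT\<close>, and the two traces agree.\<close>

lemma local_divergence_change:
  assumes x: "x \<in> U" and X: "X differentiable (at (T x))" and Y: "Y differentiable (at x)"
    and XY: "\<And>y. y \<in> U \<Longrightarrow> X (T y) = DT y (Y y)"
  shows "local_divergence H X (T x) = local_divergence G Y x"
  unfolding local_divergence_def
proof (rule trace_similar[where D = "DT x"])
  show "linear (covariant_derivative G Y x)" "linear (covariant_derivative H X (T x))"
    "linear (DT x)" "inj (DT x)"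
    using linear_covariant_derivative G H x TU[OF x] X Y linear_DT inj_DT by blast+
  fix v
  have "((\<lambda>y. X (T y)) has_derivative (\<lambda>h. frechet_derivative X (at (T x)) (DT x h))) (at x)"
    by (rule has_derivative_compose[OF smooth_on_has_derivative[OF T x]])
      (use X in \<open>simp add: frechet_derivative_works\<close>)
  moreover have "((\<lambda>y. DT y (Y y)) has_derivative
      (\<lambda>h. D2T x h (Y x) + DT x (frechet_derivative Y (at x) h))) (at x)"
    by (rule has_derivative_linear_family[OF open_U x linear_DT DT_has_derivative[OF x]])
      (use Y in \<open>simp_all add: frechet_derivative_works\<close>)
  then have "((\<lambda>y. X (T y)) has_derivative
      (\<lambda>h. D2T x h (Y x) + DT x (frechet_derivative Y (at x) h))) (at x)"
    by (rule has_derivative_transform_within_open[OF _ open_U x]) (simp add: XY)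
  ultimately have "(\<lambda>h. frechet_derivative X (at (T x)) (DT x h)) =
      (\<lambda>h. D2T x h (Y x) + DT x (frechet_derivative Y (at x) h))"
    by (rule has_derivative_unique)
  from fun_cong[OF this, of v]
  show "covariant_derivative H X (T x) (DT x v) = DT x (covariant_derivative G Y x v)"
    by (simp add: covariant_derivative_def XY[OF x] linear_add[OF linear_DT[OF x]] christoffel_change[OF x])
qed

lemma local_laplacian_change:
  assumes x: "x \<in> U" and f: "smooth_on V f" and g: "smooth_on U g"
    and fg: "\<And>y. y \<in> U \<Longrightarrow> g y = f (T y)"
  shows "local_laplacian H f (T x) = local_laplacian G g x"
  unfolding local_laplacian_def
proof (rule local_divergence_change[OF x])
  show "local_gradient H f differentiable at (T x)" "local_gradient G g differentiable at x"
    using differentiable_local_gradient G H f g x TU by blast+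
  show "local_gradient H f (T y) = DT y (local_gradient G g y)" if "y \<in> U" for y
    by (rule local_gradient_change[OF that smooth_on_differentiable[OF f TU[OF that]] fg])
qed

end


section \<open>Products in a chart\<close>

text \<open>The coordinate expression of the product of two metrics.\<close>

definition product_metric ::
  "('m \<Rightarrow> 'm \<Rightarrow> 'm \<Rightarrow> real) \<Rightarrow> ('n \<Rightarrow> 'n \<Rightarrow> 'n \<Rightarrow> real)
    \<Rightarrow> 'm \<times> 'n \<Rightarrow> 'm \<times> 'n \<Rightarrow> 'm \<times> 'n \<Rightarrow> real" where
  "product_metric G1 G2 z u v = G1 (fst z) (fst u) (fst v) + G2 (snd z) (snd u) (snd v)"

lemma inner_product_form_product:
  assumes "inner_product_form g1" "inner_product_form g2"
  shows "inner_product_form (\<lambda>u v. g1 (fst u) (fst v) + g2 (snd u) (snd v))"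
proof -
  note l1 = inner_product_form_linear[OF assms(1)]
  note l2 = inner_product_form_linear[OF assms(2)]
  have "bilinear (\<lambda>u v. g1 (fst u) (fst v) + g2 (snd u) (snd v))"
    unfolding bilinear_def
    by (intro conjI allI linearI)
      (simp_all add: linear_add[OF l1(1)] linear_add[OF l1(2)] linear_add[OF l2(1)] linear_add[OF l2(2)]
        linear_cmul[OF l1(1)] linear_cmul[OF l1(2)] linear_cmul[OF l2(1)] linear_cmul[OF l2(2)]
        distrib_left)
  moreover have "0 < g1 (fst u) (fst u) + g2 (snd u) (snd u)" if "u \<noteq> 0" for u
  proof -
    have nonneg: "g1 a a \<ge> 0" "g2 b b \<ge> 0" for a b
      using assms linear_0[OF l1(1)] linear_0[OF l2(1)] unfolding inner_product_form_def
      by (metis less_eq_real_def)+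
    have "fst u \<noteq> 0 \<or> snd u \<noteq> 0" using that by (auto simp: prod_eq_iff)
    then show ?thesis
    proof
      assume "fst u \<noteq> 0"
      then have "g1 (fst u) (fst u) > 0" using assms(1) unfolding inner_product_form_def by blast
      then show ?thesis using nonneg(2)[of "snd u"] by simp
    next
      assume "snd u \<noteq> 0"
      then have "g2 (snd u) (snd u) > 0" using assms(2) unfolding inner_product_form_def by blast
      then show ?thesis using nonneg(1)[of "fst u"] by simp
    qed
  qed
  ultimately show ?thesis
    unfolding inner_product_form_def
    using inner_product_form_sym[OF assms(1)] inner_product_form_sym[OF assms(2)]
    by (metis (no_types))
qed

lemma riemannian_metric_on_product:
  assumes G1: "riemannian_metric_on S1 G1" and G2: "riemannian_metric_on S2 G2"
  shows "riemannian_metric_on (S1 \<times> S2) (product_metric G1 G2)"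
proof -
  have op: "open (S1 \<times> S2)"
    using riemannian_metric_onD(1)[OF G1] riemannian_metric_onD(1)[OF G2] by (rule open_Times)
  moreover have "inner_product_form (product_metric G1 G2 z)" if "z \<in> S1 \<times> S2" for z
  proof -
    have "inner_product_form (G1 (fst z))" "inner_product_form (G2 (snd z))"
      using riemannian_metric_onD(2)[OF G1] riemannian_metric_onD(2)[OF G2] that by auto
    from inner_product_form_product[OF this] show ?thesis
      by (simp add: product_metric_def[abs_def])
  qed
  moreover have "smooth_on (S1 \<times> S2) (\<lambda>z. product_metric G1 G2 z u v)" for u v
    unfolding product_metric_def
  proof (rule smooth_on_add[OF op])
    show "smooth_on (S1 \<times> S2) (\<lambda>z. G1 (fst z) (fst u) (fst v))"
      by (rule smooth_on_comp_bounded_linear[OF bounded_linear_fst op _ riemannian_metric_onD(3)[OF G1]]) auto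
    show "smooth_on (S1 \<times> S2) (\<lambda>z. G2 (snd z) (snd u) (snd v))"
      by (rule smooth_on_comp_bounded_linear[OF bounded_linear_snd op _ riemannian_metric_onD(3)[OF G2]]) auto
  qed
  ultimately show ?thesis unfolding riemannian_metric_on_def by blast
qed

text \<open>Partial derivatives are total derivatives in the directions \<open>(h, 0)\<close> and \<open>(0, h)\<close>.\<close>

lemma has_derivative_slice:
  assumes "f differentiable (at (x, y))"
  shows "((\<lambda>x. f (x, y)) has_derivative (\<lambda>h. frechet_derivative f (at (x, y)) (h, 0))) (at x)"
    and "((\<lambda>y. f (x, y)) has_derivative (\<lambda>h. frechet_derivative f (at (x, y)) (0, h))) (at y)"
proof -
  have f: "(f has_derivative frechet_derivative f (at (x, y))) (at (x, y))"
    using assms by (simp add: frechet_derivative_works)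
  show "((\<lambda>x. f (x, y)) has_derivative (\<lambda>h. frechet_derivative f (at (x, y)) (h, 0))) (at x)"
    by (rule has_derivative_compose[OF has_derivative_Pair[OF has_derivative_ident has_derivative_const] f])
  show "((\<lambda>y. f (x, y)) has_derivative (\<lambda>h. frechet_derivative f (at (x, y)) (0, h))) (at y)"
    by (rule has_derivative_compose[OF has_derivative_Pair[OF has_derivative_const has_derivative_ident] f])
qed

lemma local_gradient_product:
  assumes g1: "inner_product_form (G1 x)" and g2: "inner_product_form (G2 y)"
    and f: "f differentiable (at (x, y))"
  shows "local_gradient (product_metric G1 G2) f (x, y) =
    (local_gradient G1 (\<lambda>x. f (x, y)) x, local_gradient G2 (\<lambda>y. f (x, y)) y)"
proof -
  note s = has_derivative_slice[OF f]
  note d = differentiableI[OF s(1)] differentiableI[OF s(2)]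
  have "product_metric G1 G2 (x, y)
      (local_gradient G1 (\<lambda>x. f (x, y)) x, local_gradient G2 (\<lambda>y. f (x, y)) y) v
    = frechet_derivative f (at (x, y)) v" for v
  proof -
    have "product_metric G1 G2 (x, y)
      (local_gradient G1 (\<lambda>x. f (x, y)) x, local_gradient G2 (\<lambda>y. f (x, y)) y) v =
      frechet_derivative f (at (x, y)) (fst v, 0) + frechet_derivative f (at (x, y)) (0, snd v)"
      by (simp add: product_metric_def local_gradient_works[of G1, OF g1 d(1)]
          local_gradient_works[of G2, OF g2 d(2)]
          frechet_derivative_eqI[OF s(1)] frechet_derivative_eqI[OF s(2)])
    also have "\<dots> = frechet_derivative f (at (x, y)) v"
      by (simp flip: linear_add[OF linear_frechet_derivative[OF f]])
    finally show ?thesis .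
  qed
  moreover have "inner_product_form (product_metric G1 G2 (x, y))"
    using inner_product_form_product[OF g1 g2] by (simp add: product_metric_def[abs_def])
  ultimately show ?thesis
    unfolding local_gradient_def[of "product_metric G1 G2"] by (intro sharp_eqI)
qed

lemma product_metric_derivative:
  assumes G1: "riemannian_metric_on S1 G1" and G2: "riemannian_metric_on S2 G2"
    and x: "x \<in> S1" and y: "y \<in> S2"
  shows "frechet_derivative (\<lambda>z. product_metric G1 G2 z u v) (at (x, y)) h =
    frechet_derivative (\<lambda>z. G1 z (fst u) (fst v)) (at x) (fst h) +
    frechet_derivative (\<lambda>z. G2 z (snd u) (snd v)) (at y) (snd h)"
proof -
  have "((\<lambda>z. G1 (fst z) (fst u) (fst v)) has_derivative
      (\<lambda>h. frechet_derivative (\<lambda>z. G1 z (fst u) (fst v)) (at x) (fst h))) (at (x, y))"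
    by (rule has_derivative_compose[OF bounded_linear_imp_has_derivative[OF bounded_linear_fst]])
      (use smooth_on_has_derivative[OF riemannian_metric_onD(3)[OF G1] x] in simp)
  moreover have "((\<lambda>z. G2 (snd z) (snd u) (snd v)) has_derivative
      (\<lambda>h. frechet_derivative (\<lambda>z. G2 z (snd u) (snd v)) (at y) (snd h))) (at (x, y))"
    by (rule has_derivative_compose[OF bounded_linear_imp_has_derivative[OF bounded_linear_snd]])
      (use smooth_on_has_derivative[OF riemannian_metric_onD(3)[OF G2] y] in simp)
  ultimately show ?thesis
    unfolding product_metric_def by (simp add: frechet_derivative_eqI[OF has_derivative_add])
qed

lemma christoffel_product:
  assumes G1: "riemannian_metric_on S1 G1" and G2: "riemannian_metric_on S2 G2"
    and x: "x \<in> S1" and y: "y \<in> S2"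
  shows "christoffel (product_metric G1 G2) (x, y) u v =
    (christoffel G1 x (fst u) (fst v), christoffel G2 y (snd u) (snd v))"
  unfolding christoffel_koszul[of "product_metric G1 G2"]
proof (rule sharp_eqI)
  show "inner_product_form (product_metric G1 G2 (x, y))"
    using riemannian_metric_onD(2)[OF riemannian_metric_on_product[OF G1 G2]] x y by blast
  show "product_metric G1 G2 (x, y)
      (christoffel G1 x (fst u) (fst v), christoffel G2 y (snd u) (snd v)) w =
      koszul_form (product_metric G1 G2) (x, y) u v w" for w
    unfolding koszul_form_def product_metric_derivative[OF assms]
    by (simp add: product_metric_def christoffel_works[OF G1 x] christoffel_works[OF G2 y]
        koszul_form_def field_simps)
qed

lemma local_divergence_product:
  assumes G1: "riemannian_metric_on S1 G1" and G2: "riemannian_metric_on S2 G2"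
    and x: "x \<in> S1" and y: "y \<in> S2" and X: "X differentiable (at (x, y))"
  shows "local_divergence (product_metric G1 G2) X (x, y) =
    local_divergence G1 (\<lambda>x. fst (X (x, y))) x + local_divergence G2 (\<lambda>y. snd (X (x, y))) y"
proof -
  note s = has_derivative_slice[OF X]
  have d1: "frechet_derivative (\<lambda>x. fst (X (x, y))) (at x) =
      (\<lambda>h. fst (frechet_derivative X (at (x, y)) (h, 0)))"
    by (rule frechet_derivative_eqI, rule has_derivative_fst, rule s)
  have d2: "frechet_derivative (\<lambda>y. snd (X (x, y))) (at y) =
      (\<lambda>h. snd (frechet_derivative X (at (x, y)) (0, h)))"
    by (rule frechet_derivative_eqI, rule has_derivative_snd, rule s)
  have "local_divergence (product_metric G1 G2) X (x, y) =
      (\<Sum>b\<in>Basis. covariant_derivative (product_metric G1 G2) X (x, y) (b, 0) \<bullet> (b, 0)) +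
      (\<Sum>b\<in>Basis. covariant_derivative (product_metric G1 G2) X (x, y) (0, b) \<bullet> (0, b))"
    unfolding local_divergence_def Basis_prod_def
    by (subst sum.union_disjoint) (auto simp: sum.reindex inj_on_def)
  also have "\<dots> = (\<Sum>b\<in>Basis. covariant_derivative G1 (\<lambda>x. fst (X (x, y))) x b \<bullet> b) +
      (\<Sum>b\<in>Basis. covariant_derivative G2 (\<lambda>y. snd (X (x, y))) y b \<bullet> b)"
    by (simp add: covariant_derivative_def christoffel_product[OF G1 G2 x y] d1 d2 inner_prod_def)
  finally show ?thesis by (simp add: local_divergence_def)
qed

lemma local_laplacian_product:
  assumes G1: "riemannian_metric_on S1 G1" and G2: "riemannian_metric_on S2 G2"
    and x: "x \<in> S1" and y: "y \<in> S2" and f: "smooth_on (S1 \<times> S2) f"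
  shows "local_laplacian (product_metric G1 G2) f (x, y) =
    local_laplacian G1 (\<lambda>x. f (x, y)) x + local_laplacian G2 (\<lambda>y. f (x, y)) y"
proof -
  let ?X = "local_gradient (product_metric G1 G2) f"
  have grad: "?X (a, b) = (local_gradient G1 (\<lambda>x. f (x, b)) a, local_gradient G2 (\<lambda>y. f (a, y)) b)"
    if "a \<in> S1" "b \<in> S2" for a b
    using local_gradient_product[of G1 a G2 b f] riemannian_metric_onD(2)[OF G1 that(1)]
      riemannian_metric_onD(2)[OF G2 that(2)] smooth_on_differentiable[OF f, of "(a, b)"] that by blast
  have X: "?X differentiable (at (x, y))"
    by (rule differentiable_local_gradient[OF riemannian_metric_on_product[OF G1 G2] f])
      (use x y in simp)
  note s = has_derivative_slice[OF X]
  have slice: "(\<lambda>x. fst (?X (x, y))) differentiable (at x)" "(\<lambda>y. snd (?X (x, y))) differentiable (at y)"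
    using has_derivative_fst[OF s(1)] has_derivative_snd[OF s(2)] by (auto simp: differentiable_def)
  have "local_divergence G1 (local_gradient G1 (\<lambda>x. f (x, y))) x = local_divergence G1 (\<lambda>x. fst (?X (x, y))) x"
    by (rule local_divergence_cong[OF riemannian_metric_onD(1)[OF G1] x _ slice(1)]) (simp add: grad y)
  moreover have "local_divergence G2 (local_gradient G2 (\<lambda>y. f (x, y))) y = local_divergence G2 (\<lambda>y. snd (?X (x, y))) y"
    by (rule local_divergence_cong[OF riemannian_metric_onD(1)[OF G2] y _ slice(2)]) (simp add: grad x)
  ultimately show ?thesis
    unfolding local_laplacian_def local_divergence_product[OF G1 G2 x y X] by simp
qed


section \<open>Complex-valued functions in a chart\<close>

text \<open>The tension field in coordinates.\<close>

definition local_tension ::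
  "('m::euclidean_space \<Rightarrow> 'm \<Rightarrow> 'm \<Rightarrow> real) \<Rightarrow> ('m \<Rightarrow> complex) \<Rightarrow> 'm \<Rightarrow> complex" where
  "local_tension G f x =
     Complex (local_laplacian G (\<lambda>y. Re (f y)) x) (local_laplacian G (\<lambda>y. Im (f y)) x)"

text \<open>The gradient in coordinates, as the pair of the gradients of the real and imaginary parts.\<close>

definition local_complex_gradient ::
  "('m::euclidean_space \<Rightarrow> 'm \<Rightarrow> 'm \<Rightarrow> real) \<Rightarrow> ('m \<Rightarrow> complex) \<Rightarrow> 'm \<Rightarrow> 'm complexified" where
  "local_complex_gradient G f x =
     (local_gradient G (\<lambda>y. Re (f y)) x, local_gradient G (\<lambda>y. Im (f y)) x)"

text \<open>The conformality operator in coordinates.\<close>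

definition local_conformality ::
  "('m::euclidean_space \<Rightarrow> 'm \<Rightarrow> 'm \<Rightarrow> real) \<Rightarrow> ('m \<Rightarrow> complex) \<Rightarrow> ('m \<Rightarrow> complex) \<Rightarrow> 'm \<Rightarrow> complex" where
  "local_conformality G f h x =
     complex_bilinear_ext (G x) (local_complex_gradient G f x) (local_complex_gradient G h x)"

lemma smooth_on_Re_Im:
  assumes "open S" "smooth_on S f"
  shows "smooth_on S (\<lambda>x. Re (f x))" "smooth_on S (\<lambda>x. Im (f x))"
  by (rule smooth_on_bounded_linear[OF bounded_linear_Re assms])
    (rule smooth_on_bounded_linear[OF bounded_linear_Im assms])

lemma local_gradient_cong:
  assumes "open S" "x \<in> S" "\<And>y. y \<in> S \<Longrightarrow> f y = h y" "h differentiable (at x)"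
  shows "local_gradient G f x = local_gradient G h x"
proof -
  have "(f has_derivative frechet_derivative h (at x)) (at x)"
    by (rule has_derivative_transform_within_open[of h _ x UNIV S])
      (use assms in \<open>simp_all add: frechet_derivative_works\<close>)
  then show ?thesis
    unfolding local_gradient_def by (simp add: frechet_derivative_eqI)
qed

lemma local_laplacian_cong:
  assumes G: "riemannian_metric_on S G" and x: "x \<in> S"
    and eq: "\<And>y. y \<in> S \<Longrightarrow> f y = h y" and h: "smooth_on S h"
  shows "local_laplacian G f x = local_laplacian G h x"
  unfolding local_laplacian_def
proof (rule local_divergence_cong[OF riemannian_metric_onD(1)[OF G] x])
  show "local_gradient G f y = local_gradient G h y" if "y \<in> S" for y
    by (rule local_gradient_cong[OF riemannian_metric_onD(1)[OF G] that eq smooth_on_differentiable[OF h that]])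
  show "local_gradient G h differentiable at x"
    by (rule differentiable_local_gradient[OF G h x])
qed

lemma local_tension_cong:
  assumes G: "riemannian_metric_on S G" and x: "x \<in> S"
    and eq: "\<And>y. y \<in> S \<Longrightarrow> f y = h y" and h: "smooth_on S h"
  shows "local_tension G f x = local_tension G h x"
proof -
  note r = smooth_on_Re_Im[OF riemannian_metric_onD(1)[OF G] h]
  have "local_laplacian G (\<lambda>y. Re (f y)) x = local_laplacian G (\<lambda>y. Re (h y)) x"
    by (rule local_laplacian_cong[OF G x _ r(1)]) (simp add: eq)
  moreover have "local_laplacian G (\<lambda>y. Im (f y)) x = local_laplacian G (\<lambda>y. Im (h y)) x"
    by (rule local_laplacian_cong[OF G x _ r(2)]) (simp add: eq)
  ultimately show ?thesis by (simp add: local_tension_def)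
qed

lemma local_complex_gradient_cong:
  assumes G: "riemannian_metric_on S G" and x: "x \<in> S"
    and eq: "\<And>y. y \<in> S \<Longrightarrow> f y = h y" and h: "smooth_on S h"
  shows "local_complex_gradient G f x = local_complex_gradient G h x"
proof -
  note r = smooth_on_Re_Im[OF riemannian_metric_onD(1)[OF G] h]
  have "local_gradient G (\<lambda>y. Re (f y)) x = local_gradient G (\<lambda>y. Re (h y)) x"
    by (rule local_gradient_cong[OF riemannian_metric_onD(1)[OF G] x _ smooth_on_differentiable[OF r(1) x]])
      (simp add: eq)
  moreover have "local_gradient G (\<lambda>y. Im (f y)) x = local_gradient G (\<lambda>y. Im (h y)) x"
    by (rule local_gradient_cong[OF riemannian_metric_onD(1)[OF G] x _ smooth_on_differentiable[OF r(2) x]])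
      (simp add: eq)
  ultimately show ?thesis by (simp add: local_complex_gradient_def)
qed

lemma local_tension_mult_const:
  assumes G: "riemannian_metric_on S G" and x: "x \<in> S" and f: "smooth_on S f"
  shows "local_tension G (\<lambda>y. c * f y) x = c * local_tension G f x"
proof -
  note r = smooth_on_Re_Im[OF riemannian_metric_onD(1)[OF G] f]
  show ?thesis
    using local_laplacian_lincomb[OF G x r, of "Re c" "- Im c"]
      local_laplacian_lincomb[OF G x r(2) r(1), of "Re c" "Im c"]
    by (simp add: local_tension_def complex_eq_iff)
qed

lemma local_complex_gradient_mult_const:
  assumes G: "riemannian_metric_on S G" and x: "x \<in> S" and f: "smooth_on S f"
  shows "local_complex_gradient G (\<lambda>y. c * f y) x =
    (Re c *\<^sub>R fst (local_complex_gradient G f x) - Im c *\<^sub>R snd (local_complex_gradient G f x),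
     Im c *\<^sub>R fst (local_complex_gradient G f x) + Re c *\<^sub>R snd (local_complex_gradient G f x))"
proof -
  note r = smooth_on_Re_Im[OF riemannian_metric_onD(1)[OF G] f]
  note d = smooth_on_differentiable[OF r(1) x] smooth_on_differentiable[OF r(2) x]
  show ?thesis
    using local_gradient_lincomb[of G x "\<lambda>x. Re (f x)" "\<lambda>x. Im (f x)" "Re c" "- Im c",
        OF riemannian_metric_onD(2)[OF G x] d]
      local_gradient_lincomb[of G x "\<lambda>x. Im (f x)" "\<lambda>x. Re (f x)" "Re c" "Im c",
        OF riemannian_metric_onD(2)[OF G x] d(2) d(1)]
    by (simp add: local_complex_gradient_def add.commute)
qed

lemma local_conformality_mult_const:
  assumes G: "riemannian_metric_on S G" and x: "x \<in> S" and f: "smooth_on S f" and h: "smooth_on S h"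
  shows "local_conformality G (\<lambda>y. c * f y) (\<lambda>y. d * h y) x = c * d * local_conformality G f h x"
proof -
  note l = inner_product_form_linear[OF riemannian_metric_onD(2)[OF G x]]
  show ?thesis
    unfolding local_conformality_def local_complex_gradient_mult_const[OF G x f]
      local_complex_gradient_mult_const[OF G x h]
    by (simp add: complex_bilinear_ext_def complex_eq_iff linear_add[OF l(1)] linear_add[OF l(2)]
        linear_diff[OF l(1)] linear_diff[OF l(2)] linear_cmul[OF l(1)] linear_cmul[OF l(2)]
        algebra_simps)
qed

lemma local_tension_product:
  assumes G1: "riemannian_metric_on S1 G1" and G2: "riemannian_metric_on S2 G2"
    and x: "x \<in> S1" and y: "y \<in> S2" and f: "smooth_on (S1 \<times> S2) f"
  shows "local_tension (product_metric G1 G2) f (x, y) =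
    local_tension G1 (\<lambda>x. f (x, y)) x + local_tension G2 (\<lambda>y. f (x, y)) y"
proof -
  note r = smooth_on_Re_Im[OF open_Times[OF riemannian_metric_onD(1)[OF G1] riemannian_metric_onD(1)[OF G2]] f]
  show ?thesis
    by (simp add: local_tension_def local_laplacian_product[OF G1 G2 x y r(1)]
        local_laplacian_product[OF G1 G2 x y r(2)] complex_eq_iff)
qed

lemma local_conformality_product:
  assumes G1: "riemannian_metric_on S1 G1" and G2: "riemannian_metric_on S2 G2"
    and x: "x \<in> S1" and y: "y \<in> S2"
    and f: "smooth_on (S1 \<times> S2) f" and h: "smooth_on (S1 \<times> S2) h"
  shows "local_conformality (product_metric G1 G2) f h (x, y) =
    local_conformality G1 (\<lambda>x. f (x, y)) (\<lambda>x. h (x, y)) x +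
    local_conformality G2 (\<lambda>y. f (x, y)) (\<lambda>y. h (x, y)) y"
proof -
  note op = open_Times[OF riemannian_metric_onD(1)[OF G1] riemannian_metric_onD(1)[OF G2]]
  have xy: "(x, y) \<in> S1 \<times> S2" using x y by simp
  note grad = local_gradient_product[of G1 x G2 y, OF riemannian_metric_onD(2)[OF G1 x] riemannian_metric_onD(2)[OF G2 y]
      smooth_on_differentiable[OF _ xy]]
  show ?thesis
    by (simp add: local_conformality_def local_complex_gradient_def
        grad[OF smooth_on_Re_Im(1)[OF op f]] grad[OF smooth_on_Re_Im(2)[OF op f]]
        grad[OF smooth_on_Re_Im(1)[OF op h]] grad[OF smooth_on_Re_Im(2)[OF op h]]
        complex_bilinear_ext_def product_metric_def complex_eq_iff)
qed


section \<open>Independence of the chart\<close>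

lemma riemannian_metric_on_chart:
  assumes "riemannian_manifold M" "i \<in> rm_index M"
  shows "riemannian_metric_on (chart_image M i) (rm_metric M i)"
  using assms unfolding riemannian_manifold_def smooth_manifold_def riemannian_metric_on_def by blast

lemma smooth_manifold_chart:
  assumes "smooth_manifold M" "i \<in> rm_index M"
  shows "openin (rm_top M) (rm_dom M i)" "open (chart_image M i)"
    "homeomorphic_map (subtopology (rm_top M) (rm_dom M i)) (top_of_set (chart_image M i)) (rm_chart M i)"
  using assms unfolding smooth_manifold_def by blast+

lemma inj_on_chart:
  assumes "smooth_manifold M" "i \<in> rm_index M"
  shows "inj_on (rm_chart M i) (rm_dom M i)"
  using homeomorphic_imp_injective_map[OF smooth_manifold_chart(3)[OF assms]]
    openin_subset[OF smooth_manifold_chart(1)[OF assms]]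
  by (simp add: inf_absorb2)

lemma chart_inv_chart:
  assumes "smooth_manifold M" "i \<in> rm_index M" "p \<in> rm_dom M i"
  shows "chart_inv M i (rm_chart M i p) = p"
  unfolding chart_inv_def by (rule inv_into_f_f[OF inj_on_chart[OF assms(1,2)] assms(3)])

lemma open_chart_overlap:
  assumes M: "smooth_manifold M" and i: "i \<in> rm_index M" and j: "j \<in> rm_index M"
  shows "open (rm_chart M i ` (rm_dom M i \<inter> rm_dom M j))"
proof -
  have "openin (subtopology (rm_top M) (rm_dom M i)) (rm_dom M i \<inter> rm_dom M j)"
    using smooth_manifold_chart(1)[OF M i] smooth_manifold_chart(1)[OF M j]
    by (simp add: openin_open_subtopology openin_Int)
  then have "openin (top_of_set (chart_image M i)) (rm_chart M i ` (rm_dom M i \<inter> rm_dom M j))"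
    using homeomorphic_imp_open_map[OF smooth_manifold_chart(3)[OF M i]] unfolding open_map_def by blast
  then show ?thesis
    using smooth_manifold_chart(2)[OF M i] by (simp add: openin_open_eq)
qed

lemma smooth_transition:
  assumes "smooth_manifold M" "i \<in> rm_index M" "j \<in> rm_index M"
  shows "smooth_on (rm_chart M i ` (rm_dom M i \<inter> rm_dom M j)) (transition M i j)"
  using assms unfolding smooth_manifold_def by blast

lemma isometric_change_charts:
  assumes M: "riemannian_manifold M" and i: "i \<in> rm_index M" and j: "j \<in> rm_index M"
  shows "isometric_change (rm_chart M i ` (rm_dom M i \<inter> rm_dom M j)) (chart_image M j)
    (transition M i j) (rm_metric M i) (rm_metric M j)"
proof
  have sm: "smooth_manifold M" using M unfolding riemannian_manifold_def by blast
  let ?U = "rm_chart M i ` (rm_dom M i \<inter> rm_dom M j)"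
  have sub: "?U \<subseteq> chart_image M i" unfolding chart_image_def by blast
  show "riemannian_metric_on ?U (rm_metric M i)"
    using riemannian_metric_on_chart[OF M i] open_chart_overlap[OF sm i j] smooth_on_subset[OF _ sub] sub
    unfolding riemannian_metric_on_def by blast
  show "riemannian_metric_on (chart_image M j) (rm_metric M j)"
    by (rule riemannian_metric_on_chart[OF M j])
  show "smooth_on ?U (transition M i j)"
    by (rule smooth_transition[OF sm i j])
  show "transition M i j x \<in> chart_image M j" if "x \<in> ?U" for x
    using that chart_inv_chart[OF sm i] by (auto simp: transition_def chart_image_def)
  show "rm_metric M i x u v =
      rm_metric M j (transition M i j x) (frechet_derivative (transition M i j) (at x) u)
        (frechet_derivative (transition M i j) (at x) v)" if "x \<in> ?U" for x u v
    using M i j that unfolding riemannian_manifold_def by blast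
qed

lemma coord_rep_change:
  assumes "smooth_manifold M" "i \<in> rm_index M" "j \<in> rm_index M"
    "x \<in> rm_chart M i ` (rm_dom M i \<inter> rm_dom M j)"
  shows "coord_rep M f i x = coord_rep M f j (transition M i j x)"
  using assms by (auto simp: coord_rep_def transition_def chart_inv_chart)

lemma chart_at_works:
  assumes "smooth_manifold M" "p \<in> topspace (rm_top M)"
  shows "chart_at M p \<in> rm_index M" "p \<in> rm_dom M (chart_at M p)"
proof -
  have "\<exists>i. i \<in> rm_index M \<and> p \<in> rm_dom M i"
    using assms unfolding smooth_manifold_def by blast
  from someI_ex[OF this]
  show "chart_at M p \<in> rm_index M" "p \<in> rm_dom M (chart_at M p)"
    unfolding chart_at_def by blast+
qed

lemma smooth_coord_rep:
  "smooth_function M f \<Longrightarrow> i \<in> rm_index M \<Longrightarrow> smooth_on (chart_image M i) (coord_rep M f i)"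
  unfolding smooth_function_def by blast

text \<open>The tension field can be computed in any chart around \<open>p\<close>, not only in the one picked by \<open>chart_at\<close>.\<close>

lemma tension_field_in_chart:
  assumes M: "riemannian_manifold M" and f: "smooth_function M f"
    and i: "i \<in> rm_index M" and p: "p \<in> rm_dom M i"
  shows "tension_field M f p = local_tension (rm_metric M i) (coord_rep M f i) (rm_chart M i p)"
proof -
  have sm: "smooth_manifold M" using M unfolding riemannian_manifold_def by blast
  have "p \<in> topspace (rm_top M)"
    using openin_subset[OF smooth_manifold_chart(1)[OF sm i]] p by blast
  note j = chart_at_works[OF sm this]
  define j where "j = chart_at M p"
  let ?U = "rm_chart M i ` (rm_dom M i \<inter> rm_dom M j)"
  note j = j[folded j_def]
  interpret isometric_change ?U "chart_image M j" "transition M i j" "rm_metric M i" "rm_metric M j"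
    by (rule isometric_change_charts[OF M i j(1)])
  have x: "rm_chart M i p \<in> ?U" using p j(2) by blast
  have Tx: "transition M i j (rm_chart M i p) = rm_chart M j p"
    by (simp add: transition_def chart_inv_chart[OF sm i p])
  have sub: "?U \<subseteq> chart_image M i" unfolding chart_image_def by blast
  note fi = smooth_on_Re_Im[OF open_U smooth_on_subset[OF smooth_coord_rep[OF f i] sub]]
  note fj = smooth_on_Re_Im[OF open_V smooth_coord_rep[OF f j(1)]]
  have re: "local_laplacian (rm_metric M j) (\<lambda>y. Re (coord_rep M f j y)) (rm_chart M j p) =
      local_laplacian (rm_metric M i) (\<lambda>y. Re (coord_rep M f i y)) (rm_chart M i p)"
    using local_laplacian_change[OF x fj(1) fi(1)] coord_rep_change[OF sm i j(1)] Tx by metis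
  have im: "local_laplacian (rm_metric M j) (\<lambda>y. Im (coord_rep M f j y)) (rm_chart M j p) =
      local_laplacian (rm_metric M i) (\<lambda>y. Im (coord_rep M f i y)) (rm_chart M i p)"
    using local_laplacian_change[OF x fj(2) fi(2)] coord_rep_change[OF sm i j(1)] Tx by metis
  have "coord_rep M (\<lambda>p. Re (f p)) j = (\<lambda>y. Re (coord_rep M f j y))"
    "coord_rep M (\<lambda>p. Im (f p)) j = (\<lambda>y. Im (coord_rep M f j y))"
    by (simp_all add: coord_rep_def fun_eq_iff)
  with re im show ?thesis
    by (simp add: tension_field_def complex_divergence_def complex_gradient_def divergence_def
        gradient_def[abs_def] Let_def local_tension_def local_laplacian_def flip: j_def)
qed

text \<open>The same for the conformality operator, because \<open>DT\<close> preserves inner products.\<close>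

lemma conformality_operator_in_chart:
  assumes M: "riemannian_manifold M" and f: "smooth_function M f" and h: "smooth_function M h"
    and i: "i \<in> rm_index M" and p: "p \<in> rm_dom M i"
  shows "conformality_operator M f h p =
    local_conformality (rm_metric M i) (coord_rep M f i) (coord_rep M h i) (rm_chart M i p)"
proof -
  have sm: "smooth_manifold M" using M unfolding riemannian_manifold_def by blast
  have "p \<in> topspace (rm_top M)"
    using openin_subset[OF smooth_manifold_chart(1)[OF sm i]] p by blast
  note j = chart_at_works[OF sm this]
  define j where "j = chart_at M p"
  let ?U = "rm_chart M i ` (rm_dom M i \<inter> rm_dom M j)"
  note j = j[folded j_def]
  interpret isometric_change ?U "chart_image M j" "transition M i j" "rm_metric M i" "rm_metric M j"
    by (rule isometric_change_charts[OF M i j(1)])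
  let ?x = "rm_chart M i p" and ?y = "rm_chart M j p"
  have x: "?x \<in> ?U" using p j(2) by blast
  have Tx: "transition M i j ?x = ?y"
    by (simp add: transition_def chart_inv_chart[OF sm i p])
  have yV: "?y \<in> chart_image M j" using j(2) by (simp add: chart_image_def)
  have grad: "local_gradient (rm_metric M j) (\<lambda>y. Re (coord_rep M g j y)) ?y =
        DT ?x (local_gradient (rm_metric M i) (\<lambda>y. Re (coord_rep M g i y)) ?x)"
    "local_gradient (rm_metric M j) (\<lambda>y. Im (coord_rep M g j y)) ?y =
        DT ?x (local_gradient (rm_metric M i) (\<lambda>y. Im (coord_rep M g i y)) ?x)"
    if g: "smooth_function M g" for g
  proof -
    note gj = smooth_on_Re_Im[OF open_V smooth_coord_rep[OF g j(1)]]
    note d = smooth_on_differentiable[OF gj(1) yV] smooth_on_differentiable[OF gj(2) yV]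
    show "local_gradient (rm_metric M j) (\<lambda>y. Re (coord_rep M g j y)) ?y =
        DT ?x (local_gradient (rm_metric M i) (\<lambda>y. Re (coord_rep M g i y)) ?x)"
      using local_gradient_change[OF x, of "\<lambda>y. Re (coord_rep M g j y)"] d(1)
        coord_rep_change[OF sm i j(1)] Tx by metis
    show "local_gradient (rm_metric M j) (\<lambda>y. Im (coord_rep M g j y)) ?y =
        DT ?x (local_gradient (rm_metric M i) (\<lambda>y. Im (coord_rep M g i y)) ?x)"
      using local_gradient_change[OF x, of "\<lambda>y. Im (coord_rep M g j y)"] d(2)
        coord_rep_change[OF sm i j(1)] Tx by metis
  qed
  have "coord_rep M (\<lambda>p. Re (g p)) j = (\<lambda>y. Re (coord_rep M g j y))"
    "coord_rep M (\<lambda>p. Im (g p)) j = (\<lambda>y. Im (coord_rep M g j y))" for g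
    by (simp_all add: coord_rep_def fun_eq_iff)
  with grad[OF f] grad[OF h] show ?thesis
    by (simp add: conformality_operator_def complex_gradient_def gradient_def Let_def
        local_conformality_def local_complex_gradient_def complex_bilinear_ext_def
        pullback[OF x] Tx flip: j_def)
qed


section \<open>The Riemannian product\<close>

lemma second_countable_prod_topology:
  assumes "second_countable X" "second_countable Y"
  shows "second_countable (prod_topology X Y)"
proof -
  obtain A where A: "countable A" "\<forall>V\<in>A. openin X V"
    "\<forall>U x. openin X U \<and> x \<in> U \<longrightarrow> (\<exists>V\<in>A. x \<in> V \<and> V \<subseteq> U)"
    using assms(1) unfolding second_countable_def by blast
  obtain B where B: "countable B" "\<forall>V\<in>B. openin Y V"
    "\<forall>U x. openin Y U \<and> x \<in> U \<longrightarrow> (\<exists>V\<in>B. x \<in> V \<and> V \<subseteq> U)"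
    using assms(2) unfolding second_countable_def by blast
  let ?C = "(\<lambda>(U, V). U \<times> V) ` (A \<times> B)"
  have 1: "countable ?C" using A(1) B(1) by blast
  have 2: "openin (prod_topology X Y) W" if "W \<in> ?C" for W
    using that A(2) B(2) by (auto simp: openin_prod_Times_iff)
  have 3: "\<exists>W\<in>?C. z \<in> W \<and> W \<subseteq> O'" if O': "openin (prod_topology X Y) O'" and z: "z \<in> O'" for O' z
  proof -
    obtain x y where xy: "z = (x, y)" by fastforce
    obtain U V where UV: "openin X U" "openin Y V" "x \<in> U" "y \<in> V" "U \<times> V \<subseteq> O'"
      using O'[unfolded openin_prod_topology_alt, rule_format, OF z[unfolded xy]] by blast
    obtain U' where U': "U' \<in> A" "x \<in> U'" "U' \<subseteq> U" using A(3) UV(1,3) by meson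
    obtain V' where V': "V' \<in> B" "y \<in> V'" "V' \<subseteq> V" using B(3) UV(2,4) by meson
    have "U' \<times> V' \<in> ?C" using U' V' by auto
    moreover have "z \<in> U' \<times> V'" using U' V' xy by simp
    moreover have "U' \<times> V' \<subseteq> O'" using U' V' UV(5) by blast
    ultimately show ?thesis by blast
  qed
  show ?thesis unfolding second_countable_def
    using 1 2 3 by (intro exI[of _ ?C] conjI ballI allI impI) (assumption | elim conjE)+
qed

lemma homeomorphic_map_prod_topology:
  assumes "homeomorphic_map X X' f" "homeomorphic_map Y Y' g"
  shows "homeomorphic_map (prod_topology X Y) (prod_topology X' Y') (\<lambda>(x, y). (f x, g y))"
proof -
  obtain f' g' where "homeomorphic_maps X X' f f'" "homeomorphic_maps Y Y' g g'"
    using assms unfolding homeomorphic_map_maps by blast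
  then have "homeomorphic_maps (prod_topology X Y) (prod_topology X' Y')
      (\<lambda>(x, y). (f x, g y)) (\<lambda>(x, y). (f' x, g' y))"
    unfolding homeomorphic_maps_prod by (intro disjI2 conjI)
  then show ?thesis unfolding homeomorphic_map_maps by blast
qed

lemma riem_product_simps:
  "rm_top (riem_product M1 M2) = prod_topology (rm_top M1) (rm_top M2)"
  "rm_index (riem_product M1 M2) = rm_index M1 \<times> rm_index M2"
  "rm_dom (riem_product M1 M2) (i, j) = rm_dom M1 i \<times> rm_dom M2 j"
  "rm_chart (riem_product M1 M2) (i, j) = (\<lambda>(p, q). (rm_chart M1 i p, rm_chart M2 j q))"
  "rm_metric (riem_product M1 M2) (i, j) = product_metric (rm_metric M1 i) (rm_metric M2 j)"
  by (simp_all add: riem_product_def product_metric_def fun_eq_iff split_beta)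

lemma chart_image_riem_product:
  "chart_image (riem_product M1 M2) (i, j) = chart_image M1 i \<times> chart_image M2 j"
  by (auto simp: chart_image_def riem_product_simps)

lemma chart_inv_mem:
  assumes "x \<in> chart_image M i"
  shows "chart_inv M i x \<in> rm_dom M i" "rm_chart M i (chart_inv M i x) = x"
  using assms unfolding chart_inv_def chart_image_def
  by (rule inv_into_into, rule f_inv_into_f)

lemma chart_inv_riem_product:
  assumes "smooth_manifold M1" "smooth_manifold M2" "i \<in> rm_index M1" "j \<in> rm_index M2"
    and x: "x \<in> chart_image M1 i" and y: "y \<in> chart_image M2 j"
  shows "chart_inv (riem_product M1 M2) (i, j) (x, y) = (chart_inv M1 i x, chart_inv M2 j y)"
proof -
  have inj: "inj_on (\<lambda>(p, q). (rm_chart M1 i p, rm_chart M2 j q)) (rm_dom M1 i \<times> rm_dom M2 j)"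
    using inj_on_chart[OF assms(1,3)] inj_on_chart[OF assms(2,4)] by (auto simp: inj_on_def)
  show ?thesis
    unfolding chart_inv_def[of "riem_product M1 M2"] riem_product_simps
    by (rule inv_into_f_eq[OF inj]) (simp_all add: chart_inv_mem[OF x] chart_inv_mem[OF y])
qed

lemma overlap_riem_product:
  "rm_chart (riem_product M1 M2) (i, j) `
     (rm_dom (riem_product M1 M2) (i, j) \<inter> rm_dom (riem_product M1 M2) (i', j')) =
   (rm_chart M1 i ` (rm_dom M1 i \<inter> rm_dom M1 i')) \<times> (rm_chart M2 j ` (rm_dom M2 j \<inter> rm_dom M2 j'))"
  by (auto simp: riem_product_simps)

lemma transition_riem_product:
  assumes "smooth_manifold M1" "smooth_manifold M2" "i \<in> rm_index M1" "j \<in> rm_index M2"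
    and "x \<in> chart_image M1 i" "y \<in> chart_image M2 j"
  shows "transition (riem_product M1 M2) (i, j) (i', j') (x, y) =
    (transition M1 i i' x, transition M2 j j' y)"
  using chart_inv_riem_product[OF assms] by (simp add: transition_def riem_product_simps)

lemma smooth_manifold_riem_product:
  assumes M1: "smooth_manifold M1" and M2: "smooth_manifold M2"
  shows "smooth_manifold (riem_product M1 M2)"
proof -
  let ?P = "riem_product M1 M2"
  have "Hausdorff_space (rm_top ?P)" "second_countable (rm_top ?P)"
    using M1 M2 unfolding smooth_manifold_def riem_product_simps
    by (simp_all add: Hausdorff_space_prod_topology second_countable_prod_topology)
  moreover have "openin (rm_top ?P) (rm_dom ?P k) \<and> open (chart_image ?P k) \<and>
      homeomorphic_map (subtopology (rm_top ?P) (rm_dom ?P k)) (top_of_set (chart_image ?P k)) (rm_chart ?P k)"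
    if k_in: "k \<in> rm_index ?P" for k
  proof -
    obtain i j where k: "k = (i, j)" and ij: "i \<in> rm_index M1" "j \<in> rm_index M2"
      using k_in by (auto simp: riem_product_simps)
    note c1 = smooth_manifold_chart[OF M1 ij(1)] and c2 = smooth_manifold_chart[OF M2 ij(2)]
    show ?thesis
      unfolding k chart_image_riem_product riem_product_simps
      using c1(1,2) c2(1,2) homeomorphic_map_prod_topology[OF c1(3) c2(3)]
      by (simp add: openin_prod_Times_iff open_Times subtopology_Times)
  qed
  moreover have "(\<Union>k\<in>rm_index ?P. rm_dom ?P k) = topspace (rm_top ?P)"
  proof -
    have "(\<Union>k\<in>rm_index ?P. rm_dom ?P k) =
        (\<Union>i\<in>rm_index M1. rm_dom M1 i) \<times> (\<Union>j\<in>rm_index M2. rm_dom M2 j)"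
      by (auto simp: riem_product_simps)
    then show ?thesis
      using M1 M2 unfolding smooth_manifold_def by (simp add: riem_product_simps)
  qed
  moreover have "smooth_on (rm_chart ?P k ` (rm_dom ?P k \<inter> rm_dom ?P l)) (transition ?P k l)"
    if "k \<in> rm_index ?P" "l \<in> rm_index ?P" for k l
  proof -
    obtain i j i' j' where kl: "k = (i, j)" "l = (i', j')"
      and ij: "i \<in> rm_index M1" "j \<in> rm_index M2" "i' \<in> rm_index M1" "j' \<in> rm_index M2"
      using \<open>k \<in> rm_index ?P\<close> \<open>l \<in> rm_index ?P\<close> by (auto simp: riem_product_simps)
    let ?U1 = "rm_chart M1 i ` (rm_dom M1 i \<inter> rm_dom M1 i')"
    let ?U2 = "rm_chart M2 j ` (rm_dom M2 j \<inter> rm_dom M2 j')"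
    have op: "open (?U1 \<times> ?U2)"
      by (rule open_Times[OF open_chart_overlap[OF M1 ij(1,3)] open_chart_overlap[OF M2 ij(2,4)]])
    have t: "smooth_on ?U1 (transition M1 i i')" "smooth_on ?U2 (transition M2 j j')"
      by (rule smooth_transition[OF M1 ij(1,3)], rule smooth_transition[OF M2 ij(2,4)])
    have "smooth_on (?U1 \<times> ?U2) (\<lambda>z. transition M1 i i' (fst z))"
      by (rule smooth_on_comp_bounded_linear[OF bounded_linear_fst op _ t(1)]) auto
    moreover have "smooth_on (?U1 \<times> ?U2) (\<lambda>z. transition M2 j j' (snd z))"
      by (rule smooth_on_comp_bounded_linear[OF bounded_linear_snd op _ t(2)]) auto
    ultimately have "smooth_on (?U1 \<times> ?U2) (\<lambda>z. (transition M1 i i' (fst z), transition M2 j j' (snd z)))"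
      by (rule smooth_on_Pair[OF op])
    then have "smooth_on (?U1 \<times> ?U2) (transition ?P (i, j) (i', j'))"
    proof (rule smooth_on_cong[OF op, rotated])
      fix z assume "z \<in> ?U1 \<times> ?U2"
      then have "fst z \<in> chart_image M1 i" "snd z \<in> chart_image M2 j"
        by (auto simp: chart_image_def)
      from transition_riem_product[OF M1 M2 ij(1,2) this]
      show "(transition M1 i i' (fst z), transition M2 j j' (snd z)) = transition ?P (i, j) (i', j') z"
        by simp
    qed
    then show ?thesis unfolding kl overlap_riem_product .
  qed
  ultimately show ?thesis unfolding smooth_manifold_def by blast
qed

lemma riemannian_manifold_riem_product:
  assumes M1: "riemannian_manifold M1" and M2: "riemannian_manifold M2"
  shows "riemannian_manifold (riem_product M1 M2)"
proof -
  let ?P = "riem_product M1 M2"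
  have sm1: "smooth_manifold M1" and sm2: "smooth_manifold M2"
    using M1 M2 unfolding riemannian_manifold_def by blast+
  have metric: "riemannian_metric_on (chart_image ?P k) (rm_metric ?P k)" if "k \<in> rm_index ?P" for k
    using that riemannian_metric_on_product[OF riemannian_metric_on_chart[OF M1] riemannian_metric_on_chart[OF M2]]
    by (auto simp: riem_product_simps chart_image_riem_product)
  have "rm_metric ?P k z u v =
      rm_metric ?P l (transition ?P k l z) (frechet_derivative (transition ?P k l) (at z) u)
        (frechet_derivative (transition ?P k l) (at z) v)"
    if k: "k \<in> rm_index ?P" and l: "l \<in> rm_index ?P"
      and z: "z \<in> rm_chart ?P k ` (rm_dom ?P k \<inter> rm_dom ?P l)" for k l z u v
  proof -
    obtain i j i' j' where kl: "k = (i, j)" "l = (i', j')"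
      and ij: "i \<in> rm_index M1" "j \<in> rm_index M2" "i' \<in> rm_index M1" "j' \<in> rm_index M2"
      using k l by (auto simp: riem_product_simps)
    let ?U1 = "rm_chart M1 i ` (rm_dom M1 i \<inter> rm_dom M1 i')"
    let ?U2 = "rm_chart M2 j ` (rm_dom M2 j \<inter> rm_dom M2 j')"
    obtain x y where xy: "z = (x, y)" "x \<in> ?U1" "y \<in> ?U2"
      using z unfolding kl overlap_riem_product by blast
    interpret c1: isometric_change ?U1 "chart_image M1 i'" "transition M1 i i'" "rm_metric M1 i" "rm_metric M1 i'"
      by (rule isometric_change_charts[OF M1 ij(1,3)])
    interpret c2: isometric_change ?U2 "chart_image M2 j'" "transition M2 j j'" "rm_metric M2 j" "rm_metric M2 j'"
      by (rule isometric_change_charts[OF M2 ij(2,4)])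
    have trans: "transition ?P (i, j) (i', j') w = (transition M1 i i' (fst w), transition M2 j j' (snd w))"
      if "w \<in> ?U1 \<times> ?U2" for w
    proof -
      have "fst w \<in> chart_image M1 i" "snd w \<in> chart_image M2 j"
        using that by (auto simp: chart_image_def)
      from transition_riem_product[OF sm1 sm2 ij(1,2) this] show ?thesis by simp
    qed
    have "((\<lambda>w. transition M1 i i' (fst w)) has_derivative (\<lambda>h. c1.DT x (fst h))) (at (x, y))"
      by (rule has_derivative_compose[OF bounded_linear_imp_has_derivative[OF bounded_linear_fst]])
        (use smooth_on_has_derivative[OF c1.T xy(2)] in simp)
    moreover have "((\<lambda>w. transition M2 j j' (snd w)) has_derivative (\<lambda>h. c2.DT y (snd h))) (at (x, y))"
      by (rule has_derivative_compose[OF bounded_linear_imp_has_derivative[OF bounded_linear_snd]])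
        (use smooth_on_has_derivative[OF c2.T xy(3)] in simp)
    ultimately have "((\<lambda>w. (transition M1 i i' (fst w), transition M2 j j' (snd w))) has_derivative
        (\<lambda>h. (c1.DT x (fst h), c2.DT y (snd h)))) (at (x, y))"
      by (rule has_derivative_Pair)
    then have "(transition ?P (i, j) (i', j') has_derivative
        (\<lambda>h. (c1.DT x (fst h), c2.DT y (snd h)))) (at (x, y))"
      by (rule has_derivative_transform_within_open[OF _ open_Times[OF c1.open_U c2.open_U]])
        (use xy trans in auto)
    then have "frechet_derivative (transition ?P (i, j) (i', j')) (at (x, y)) =
        (\<lambda>h. (c1.DT x (fst h), c2.DT y (snd h)))"
      by (rule frechet_derivative_eqI)
    moreover have "transition ?P (i, j) (i', j') (x, y) = (transition M1 i i' x, transition M2 j j' y)"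
      using trans[of "(x, y)"] xy by simp
    ultimately show ?thesis
      by (simp add: kl xy(1) riem_product_simps product_metric_def c1.pullback[OF xy(2)] c2.pullback[OF xy(3)])
  qed
  with metric smooth_manifold_riem_product[OF sm1 sm2] show ?thesis
    unfolding riemannian_manifold_def riemannian_metric_on_def by blast
qed


section \<open>Tension field and conformality operator of a product function\<close>

lemma coord_rep_product_function:
  assumes "smooth_manifold M1" "smooth_manifold M2" "i \<in> rm_index M1" "j \<in> rm_index M2"
    and "z \<in> chart_image M1 i \<times> chart_image M2 j"
  shows "coord_rep (riem_product M1 M2) (\<lambda>(p, q). f p * h q) (i, j) z =
    coord_rep M1 f i (fst z) * coord_rep M2 h j (snd z)"
proof -
  have "fst z \<in> chart_image M1 i" "snd z \<in> chart_image M2 j" using assms(5) by auto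
  from chart_inv_riem_product[OF assms(1-4) this] show ?thesis by (simp add: coord_rep_def)
qed

lemma smooth_on_product_function:
  fixes a b :: "_ \<Rightarrow> 'c::real_normed_algebra"
  assumes "open S" "open T" "smooth_on S a" "smooth_on T b"
  shows "smooth_on (S \<times> T) (\<lambda>z. a (fst z) * b (snd z))"
proof (rule smooth_on_bounded_bilinear[OF bounded_bilinear_mult open_Times[OF assms(1,2)]])
  show "smooth_on (S \<times> T) (\<lambda>z. a (fst z))"
    by (rule smooth_on_comp_bounded_linear[OF bounded_linear_fst open_Times[OF assms(1,2)] _ assms(3)]) auto
  show "smooth_on (S \<times> T) (\<lambda>z. b (snd z))"
    by (rule smooth_on_comp_bounded_linear[OF bounded_linear_snd open_Times[OF assms(1,2)] _ assms(4)]) auto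
qed

lemma smooth_function_product_function:
  fixes f :: "'a \<Rightarrow> 'c::real_normed_algebra" and h :: "'b \<Rightarrow> 'c"
  assumes M1: "smooth_manifold M1" and M2: "smooth_manifold M2"
    and f: "smooth_function M1 f" and h: "smooth_function M2 h"
  shows "smooth_function (riem_product M1 M2) (\<lambda>(p, q). f p * h q)"
  unfolding smooth_function_def
proof
  fix k assume "k \<in> rm_index (riem_product M1 M2)"
  then obtain i j where k: "k = (i, j)" and ij: "i \<in> rm_index M1" "j \<in> rm_index M2"
    by (auto simp: riem_product_simps)
  note op = smooth_manifold_chart(2)[OF M1 ij(1)] smooth_manifold_chart(2)[OF M2 ij(2)]
  show "smooth_on (chart_image (riem_product M1 M2) k) (coord_rep (riem_product M1 M2) (\<lambda>(p, q). f p * h q) k)"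
    unfolding k chart_image_riem_product
    by (rule smooth_on_cong[OF open_Times[OF op] _
          smooth_on_product_function[OF op smooth_coord_rep[OF f ij(1)] smooth_coord_rep[OF h ij(2)]]])
      (rule coord_rep_product_function[OF M1 M2 ij, symmetric])
qed

text \<open>There is no cross term \<open>2 \<kappa>(f, h)\<close>: the two factors depend on different variables, so their
  gradients are orthogonal.\<close>

lemma tension_field_product_function:
  assumes M1: "riemannian_manifold M1" and M2: "riemannian_manifold M2"
    and f: "smooth_function M1 f" and h: "smooth_function M2 h"
    and p: "p \<in> topspace (rm_top M1)" and q: "q \<in> topspace (rm_top M2)"
  shows "tension_field (riem_product M1 M2) (\<lambda>(p, q). f p * h q) (p, q) =
    tension_field M1 f p * h q + f p * tension_field M2 h q"
proof -
  have sm1: "smooth_manifold M1" and sm2: "smooth_manifold M2"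
    using M1 M2 unfolding riemannian_manifold_def by blast+
  obtain i j where i: "i \<in> rm_index M1" "p \<in> rm_dom M1 i" and j: "j \<in> rm_index M2" "q \<in> rm_dom M2 j"
    using chart_at_works[OF sm1 p] chart_at_works[OF sm2 q] by blast
  let ?P = "riem_product M1 M2"
  let ?G1 = "rm_metric M1 i" and ?G2 = "rm_metric M2 j"
  let ?S1 = "chart_image M1 i" and ?S2 = "chart_image M2 j"
  define a where "a = coord_rep M1 f i"
  define b where "b = coord_rep M2 h j"
  let ?x = "rm_chart M1 i p" and ?y = "rm_chart M2 j q"
  have x: "?x \<in> ?S1" and y: "?y \<in> ?S2" using i j by (auto simp: chart_image_def)
  have ax: "a ?x = f p" and b_y: "b ?y = h q"
    using i j by (simp_all add: a_def b_def coord_rep_def chart_inv_chart[OF sm1] chart_inv_chart[OF sm2])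
  note G1 = riemannian_metric_on_chart[OF M1 i(1)] and G2 = riemannian_metric_on_chart[OF M2 j(1)]
  have sa: "smooth_on ?S1 a" and sb: "smooth_on ?S2 b"
    unfolding a_def b_def by (rule smooth_coord_rep[OF f i(1)], rule smooth_coord_rep[OF h j(1)])
  have sab: "smooth_on (?S1 \<times> ?S2) (\<lambda>z. a (fst z) * b (snd z))"
    by (rule smooth_on_product_function[OF riemannian_metric_onD(1)[OF G1] riemannian_metric_onD(1)[OF G2] sa sb])
  have "tension_field ?P (\<lambda>(p, q). f p * h q) (p, q) =
      local_tension (product_metric ?G1 ?G2) (coord_rep ?P (\<lambda>(p, q). f p * h q) (i, j)) (?x, ?y)"
    \<comment> \<open>\<open>(i, j)\<close> need not be the chart that \<open>chart_at\<close> picks on the product\<close>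
    using tension_field_in_chart[OF riemannian_manifold_riem_product[OF M1 M2]
        smooth_function_product_function[OF sm1 sm2 f h], of "(i, j)" "(p, q)"] i j
    by (simp add: riem_product_simps)
  also have "\<dots> = local_tension (product_metric ?G1 ?G2) (\<lambda>z. a (fst z) * b (snd z)) (?x, ?y)"
    by (rule local_tension_cong[OF riemannian_metric_on_product[OF G1 G2] _ _ sab])
      (use x y coord_rep_product_function[OF sm1 sm2 i(1) j(1)] in \<open>simp_all add: a_def b_def\<close>)
  \<comment> \<open>in each slice the other factor is a constant\<close>
  also have "\<dots> = local_tension ?G1 (\<lambda>x. b ?y * a x) ?x + local_tension ?G2 (\<lambda>y. a ?x * b y) ?y"
    using local_tension_product[OF G1 G2 x y sab] by (simp add: mult.commute)
  also have "\<dots> = b ?y * local_tension ?G1 a ?x + a ?x * local_tension ?G2 b ?y"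
    by (simp only: local_tension_mult_const[OF G1 x sa] local_tension_mult_const[OF G2 y sb])
  finally show ?thesis
    using tension_field_in_chart[OF M1 f i] tension_field_in_chart[OF M2 h j] ax b_y
    by (simp add: a_def b_def mult.commute)
qed

lemma conformality_operator_product_function:
  assumes M1: "riemannian_manifold M1" and M2: "riemannian_manifold M2"
    and f: "smooth_function M1 f" "smooth_function M1 f'"
    and h: "smooth_function M2 h" "smooth_function M2 h'"
    and p: "p \<in> topspace (rm_top M1)" and q: "q \<in> topspace (rm_top M2)"
  shows "conformality_operator (riem_product M1 M2) (\<lambda>(p, q). f p * h q) (\<lambda>(p, q). f' p * h' q) (p, q) =
    conformality_operator M1 f f' p * (h q * h' q) + f p * f' p * conformality_operator M2 h h' q"
proof -
  have sm1: "smooth_manifold M1" and sm2: "smooth_manifold M2"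
    using M1 M2 unfolding riemannian_manifold_def by blast+
  obtain i j where i: "i \<in> rm_index M1" "p \<in> rm_dom M1 i" and j: "j \<in> rm_index M2" "q \<in> rm_dom M2 j"
    using chart_at_works[OF sm1 p] chart_at_works[OF sm2 q] by blast
  let ?P = "riem_product M1 M2"
  let ?G1 = "rm_metric M1 i" and ?G2 = "rm_metric M2 j"
  let ?S1 = "chart_image M1 i" and ?S2 = "chart_image M2 j"
  let ?x = "rm_chart M1 i p" and ?y = "rm_chart M2 j q"
  define a where "a = coord_rep M1 f i"
  define a' where "a' = coord_rep M1 f' i"
  define b where "b = coord_rep M2 h j"
  define b' where "b' = coord_rep M2 h' j"
  have x: "?x \<in> ?S1" and y: "?y \<in> ?S2" using i j by (auto simp: chart_image_def)
  have val: "a ?x = f p" "a' ?x = f' p" "b ?y = h q" "b' ?y = h' q"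
    using i j
    by (simp_all add: a_def a'_def b_def b'_def coord_rep_def chart_inv_chart[OF sm1] chart_inv_chart[OF sm2])
  note G1 = riemannian_metric_on_chart[OF M1 i(1)] and G2 = riemannian_metric_on_chart[OF M2 j(1)]
  note op = riemannian_metric_onD(1)[OF G1] riemannian_metric_onD(1)[OF G2]
  have sa: "smooth_on ?S1 a" "smooth_on ?S1 a'" and sb: "smooth_on ?S2 b" "smooth_on ?S2 b'"
    unfolding a_def a'_def b_def b'_def
    by (rule smooth_coord_rep[OF f(1) i(1)], rule smooth_coord_rep[OF f(2) i(1)],
        rule smooth_coord_rep[OF h(1) j(1)], rule smooth_coord_rep[OF h(2) j(1)])
  note sab = smooth_on_product_function[OF op sa(1) sb(1)] smooth_on_product_function[OF op sa(2) sb(2)]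
  have xy: "(?x, ?y) \<in> ?S1 \<times> ?S2" using x y by simp
  note rep = local_complex_gradient_cong[OF riemannian_metric_on_product[OF G1 G2] xy
      coord_rep_product_function[OF sm1 sm2 i(1) j(1)]]
  have "conformality_operator ?P (\<lambda>(p, q). f p * h q) (\<lambda>(p, q). f' p * h' q) (p, q) =
      local_conformality (product_metric ?G1 ?G2) (coord_rep ?P (\<lambda>(p, q). f p * h q) (i, j))
        (coord_rep ?P (\<lambda>(p, q). f' p * h' q) (i, j)) (?x, ?y)"
    using conformality_operator_in_chart[OF riemannian_manifold_riem_product[OF M1 M2]
        smooth_function_product_function[OF sm1 sm2 f(1) h(1)]
        smooth_function_product_function[OF sm1 sm2 f(2) h(2)], of "(i, j)" "(p, q)"] i j
    by (simp add: riem_product_simps)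
  also have "\<dots> = local_conformality (product_metric ?G1 ?G2) (\<lambda>z. a (fst z) * b (snd z))
      (\<lambda>z. a' (fst z) * b' (snd z)) (?x, ?y)"
    using rep[OF _ sab(1)[unfolded a_def b_def]] rep[OF _ sab(2)[unfolded a'_def b'_def]]
    by (simp add: local_conformality_def a_def a'_def b_def b'_def)
  also have "\<dots> = local_conformality ?G1 (\<lambda>x. b ?y * a x) (\<lambda>x. b' ?y * a' x) ?x +
      local_conformality ?G2 (\<lambda>y. a ?x * b y) (\<lambda>y. a' ?x * b' y) ?y"
    using local_conformality_product[OF G1 G2 x y sab] by (simp add: mult.commute)
  also have "\<dots> = b ?y * b' ?y * local_conformality ?G1 a a' ?x + a ?x * a' ?x * local_conformality ?G2 b b' ?y"
    by (simp only: local_conformality_mult_const[OF G1 x sa] local_conformality_mult_const[OF G2 y sb])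
  finally show ?thesis
    using conformality_operator_in_chart[OF M1 f i] conformality_operator_in_chart[OF M2 h j] val
    by (simp add: a_def a'_def b_def b'_def mult.commute)
qed


section \<open>Product eigenfamilies\<close>

theorem theorem7p8:
  fixes M1 :: "('a, 'm::euclidean_space, 'i) riem"
    and M2 :: "('b, 'n::euclidean_space, 'j) riem"
    and E1 :: "('a \<Rightarrow> complex) set"
    and E2 :: "('b \<Rightarrow> complex) set"
    and lam1 mu1 lam2 mu2 :: complex
  assumes "riemannian_manifold M1"
    and "riemannian_manifold M2"
    and "eigenfamily M1 E1 lam1 mu1"
    and "eigenfamily M2 E2 lam2 mu2"
  shows "eigenfamily (riem_product M1 M2)
           {\<psi>. \<exists>\<phi>1\<in>E1. \<exists>\<phi>2\<in>E2. \<psi> = (\<lambda>(p1, p2). \<phi>1 p1 * \<phi>2 p2)}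
           (lam1 + lam2) (mu1 + mu2)"
proof -
  note M = assms(1,2)
  have sm: "smooth_manifold M1" "smooth_manifold M2"
    using M unfolding riemannian_manifold_def by blast+
  have smooth1: "smooth_function M1 \<phi>" if "\<phi> \<in> E1" for \<phi>
    using assms(3) that unfolding eigenfamily_def by blast
  have smooth2: "smooth_function M2 \<phi>" if "\<phi> \<in> E2" for \<phi>
    using assms(4) that unfolding eigenfamily_def by blast
  have \<tau>: "tension_field (riem_product M1 M2) (\<lambda>(p, q). \<phi>1 p * \<phi>2 q) (p, q) =
      (lam1 + lam2) * (\<phi>1 p * \<phi>2 q)"
    if \<phi>: "\<phi>1 \<in> E1" "\<phi>2 \<in> E2" and pq: "p \<in> topspace (rm_top M1)" "q \<in> topspace (rm_top M2)"
    for \<phi>1 \<phi>2 p q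
  proof -
    have "tension_field M1 \<phi>1 p = lam1 * \<phi>1 p" "tension_field M2 \<phi>2 q = lam2 * \<phi>2 q"
      using assms(3,4) \<phi> pq unfolding eigenfamily_def by blast+
    then show ?thesis
      by (simp add: tension_field_product_function[OF M smooth1[OF \<phi>(1)] smooth2[OF \<phi>(2)] pq] algebra_simps)
  qed
  have \<kappa>: "conformality_operator (riem_product M1 M2) (\<lambda>(p, q). \<phi>1 p * \<phi>2 q) (\<lambda>(p, q). \<psi>1 p * \<psi>2 q) (p, q) =
      (mu1 + mu2) * (\<phi>1 p * \<phi>2 q * (\<psi>1 p * \<psi>2 q))"
    if \<phi>: "\<phi>1 \<in> E1" "\<phi>2 \<in> E2" and \<psi>: "\<psi>1 \<in> E1" "\<psi>2 \<in> E2"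
      and pq: "p \<in> topspace (rm_top M1)" "q \<in> topspace (rm_top M2)"
    for \<phi>1 \<phi>2 \<psi>1 \<psi>2 p q
  proof -
    have "conformality_operator M1 \<phi>1 \<psi>1 p = mu1 * (\<phi>1 p * \<psi>1 p)"
      "conformality_operator M2 \<phi>2 \<psi>2 q = mu2 * (\<phi>2 q * \<psi>2 q)"
      using assms(3,4) \<phi> \<psi> pq unfolding eigenfamily_def by blast+
    then show ?thesis
      by (simp add: conformality_operator_product_function[OF M smooth1[OF \<phi>(1)] smooth1[OF \<psi>(1)]
            smooth2[OF \<phi>(2)] smooth2[OF \<psi>(2)] pq] algebra_simps)
  qed
  show ?thesis
    unfolding eigenfamily_def
    using riemannian_manifold_riem_product[OF M] smooth_function_product_function[OF sm smooth1 smooth2] \<tau> \<kappa>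
    by (auto simp: riem_product_simps)
qed

end
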